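(* Let $\{S_m\}_{m\ge0}$ be the simple random walk on $\mathbb{Z}^2$ started at $0$, and let $p\ge1$ be an integer. Let $L_n$ be the number of inner boundary points of the range $\{S_m\}_{m=0}^n$, and let $J_n^{(p)}$ (respectively $J_n^p$) be the number of those inner boundary points visited exactly $p$ times (respectively at least $p$ times) during times $0,\dots,n$. Then the limits $$\lim_{n\to\infty}EL_n\times\frac{(\log n)^2}{n},\qquad \lim_{n\to\infty}EJ_n^{(p)}\times\frac{(\log n)^2}{n},\qquad \lim_{n\to\infty}EJ_n^{p}\times\frac{(\log n)^2}{n}$$ exist. Moreover, $$\frac{\pi^2}{2}\le\lim_{n\to\infty}EL_n\times\frac{(\log n)^2}{n}\le2\pi^2,$$ $$\frac{\tilde{c}^{\,p-1}\pi^2}{4}\le\lim_{n\to\infty}EJ_n^{(p)}\times\frac{(\log n)^2}{n}\le\tilde{c}^{\,p-1}\pi^2,$$ $$\frac{\tilde{c}^{\,p-1}\pi^2}{2}\le\lim_{n\to\infty}EJ_n^{p}\times\frac{(\log n)^2}{n}\le2\tilde{c}^{\,p-1}\pi^2,$$ where $\tilde{c}=P(T_0<T_b)$ for some neighbor $b\in\mathcal{N}(0)$ of the origin.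
   Context: Simple random walk on $\mathbb{Z}^2$: $S_0=0$, $S_k=\sum_{i=1}^kX_i$ with $X_i$ i.i.d. uniform on the four nearest neighbors of the origin in the square lattice; $P$ and $E$ denote the corresponding probability and expectation. For $a\in\mathbb{Z}^2$, $\mathcal{N}(a)=\{z\in\mathbb{Z}^2:\mathrm{dist}(a,z)=1\}$ is the set of the four nearest neighbors of $a$ ($\mathrm{dist}$ is Euclidean distance). The inner boundary of the range $\{S_m\}_{m=0}^n$ is the set of points $H_n=\{S_i:0\le i\le n,\ \{S_m\}_{m=0}^n\not\supset\mathcal{N}(S_i)\}$. With $\sharp$ denoting cardinality, $L_n=\sharp H_n$, $$J_n^{p}=\sharp\{S_i\in H_n:\sharp\{m:0\le m\le n,\ S_m=S_i\}\ge p\},\qquad J_n^{(p)}=\sharp\{S_i\in H_n:\sharp\{m:0\le m\le n,\ S_m=S_i\}=p\}$$ (these count distinct points). For $a\in\mathbb{Z}^2$, $T_a=\inf\{m\ge1:S_m=a\}$. By symmetry $P(T_0<T_b)$ does not depend on the choice of $b\in\mathcal{N}(0)$. *)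

theory Defs
  imports "HOL-Probability.Probability"
begin

definition emb :: "int \<times> int \<Rightarrow> real \<times> real" where
  "emb a = (real_of_int (fst a), real_of_int (snd a))"

(* The product metric on real * real is the Euclidean one. *)
definition nbrs :: "int \<times> int \<Rightarrow> (int \<times> int) set" where
  "nbrs a = {z. dist (emb a) (emb z) = 1}"

lemma nbrs_explicit: "nbrs (x, y) = {(x + 1, y), (x - 1, y), (x, y + 1), (x, y - 1)}"
proof -
  have sq: "(u::int)\<^sup>2 + v\<^sup>2 = 1 \<longleftrightarrow> (\<bar>u\<bar> = 1 \<and> v = 0) \<or> (u = 0 \<and> \<bar>v\<bar> = 1)" (is "?l \<longleftrightarrow> ?r") for u v
  proof
    assume l: ?l
    have "u\<^sup>2 \<ge> 0" "v\<^sup>2 \<ge> 0" by simp_all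
    with l have "u\<^sup>2 = 0 \<and> v\<^sup>2 = 1 \<or> u\<^sup>2 = 1 \<and> v\<^sup>2 = 0" by linarith
    then show ?r by (auto simp: power2_eq_1_iff)
  next
    assume ?r
    then show ?l by (auto simp: abs_if split: if_splits)
  qed
  have "(u, v) \<in> nbrs (x, y) \<longleftrightarrow> (u, v) \<in> {(x + 1, y), (x - 1, y), (x, y + 1), (x, y - 1)}" for u v
  proof -
    have "(u, v) \<in> nbrs (x, y)
        \<longleftrightarrow> (real_of_int x - real_of_int u)\<^sup>2 + (real_of_int y - real_of_int v)\<^sup>2 = 1"
      by (simp add: nbrs_def emb_def dist_Pair_Pair dist_real_def)
    also have "\<dots> \<longleftrightarrow> real_of_int ((x - u)\<^sup>2 + (y - v)\<^sup>2) = real_of_int 1"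
      by simp
    also have "\<dots> \<longleftrightarrow> (x - u)\<^sup>2 + (y - v)\<^sup>2 = 1"
      by (rule of_int_eq_iff)
    also have "\<dots> \<longleftrightarrow> (u, v) \<in> {(x + 1, y), (x - 1, y), (x, y + 1), (x, y - 1)}"
      unfolding sq by auto
    finally show ?thesis .
  qed
  then show ?thesis by (intro set_eqI) (metis surj_pair)
qed

locale simple_random_walk_Z2 = prob_space M
  for M :: "'a measure" and X :: "nat \<Rightarrow> 'a \<Rightarrow> int \<times> int" +
  assumes steps_indep: "indep_vars (\<lambda>_. count_space UNIV) X {1..}"
    and steps_uniform: "i \<ge> 1 \<Longrightarrow> distr M (count_space UNIV) (X i) = measure_pmf (pmf_of_set (nbrs 0))"

(* The argument order makes "walk X w" a trajectory; the notions below are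
   functions of a trajectory s. The value X 0 is not used. *)
definition walk :: "(nat \<Rightarrow> 'a \<Rightarrow> int \<times> int) \<Rightarrow> 'a \<Rightarrow> nat \<Rightarrow> int \<times> int" where
  "walk X \<omega> k = (\<Sum>i=1..k. X i \<omega>)"

definition walk_range :: "(nat \<Rightarrow> int \<times> int) \<Rightarrow> nat \<Rightarrow> (int \<times> int) set" where
  "walk_range s n = s ` {0..n}"

definition inner_boundary :: "(nat \<Rightarrow> int \<times> int) \<Rightarrow> nat \<Rightarrow> (int \<times> int) set" where
  "inner_boundary s n = {s i | i. i \<le> n \<and> \<not> nbrs (s i) \<subseteq> walk_range s n}"

definition visits :: "(nat \<Rightarrow> int \<times> int) \<Rightarrow> nat \<Rightarrow> int \<times> int \<Rightarrow> nat" where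
  "visits s n x = card {m. m \<le> n \<and> s m = x}"

definition L :: "(nat \<Rightarrow> int \<times> int) \<Rightarrow> nat \<Rightarrow> nat" where
  "L s n = card (inner_boundary s n)"

definition J_exact :: "nat \<Rightarrow> (nat \<Rightarrow> int \<times> int) \<Rightarrow> nat \<Rightarrow> nat" where
  "J_exact p s n = card {x \<in> inner_boundary s n. visits s n x = p}"

definition J_atleast :: "nat \<Rightarrow> (nat \<Rightarrow> int \<times> int) \<Rightarrow> nat \<Rightarrow> nat" where
  "J_atleast p s n = card {x \<in> inner_boundary s n. visits s n x \<ge> p}"

(* First visit at a time m >= 1; the infimum of the empty set is \<infinity>. *)
definition T :: "(nat \<Rightarrow> int \<times> int) \<Rightarrow> int \<times> int \<Rightarrow> enat" where
  "T s a = (INF m\<in>{m. m \<ge> 1 \<and> s m = a}. enat m)"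

end

theory Submission
  imports Defs "HOL-Real_Asymp.Real_Asymp"
begin

text \<open>Decompose the boundary points according to the time of their last visit. Seen from such a point,
  the past of the walk, reversed, and its future are independent simple random walks from the origin. By
  inclusion and exclusion over the set \<open>B\<close> of neighbours that stay unvisited, the expectations become
  signed sums over \<open>B\<close> of convolutions of \<open>P(avoid B up to i, at least q returns to 0)\<close> with
  \<open>P(avoid B \<union> {0} up to n - i)\<close>. Each factor is asymptotic to a constant over the logarithm.
  This follows from \<open>P(T\<^sub>0 > m) \<sim> \<pi> / ln m\<close> by first passage and last exit decompositions,
  because convolving a summable sequence bounded by \<open>C / k\<close> with a sequence asymptotic to
  \<open>\<gamma> / ln m\<close> multiplies \<open>\<gamma>\<close> by the sum of the former. For \<open>B = {b}\<close> the constants are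
  explicit, since \<open>P(T\<^sub>b > m) = P(T\<^sub>0 > m + 1)\<close> forces \<open>P(T\<^sub>0 < T\<^sub>b) = 1/2\<close>;
  the bounds then come from comparing the four neighbours with a single one.\<close>

subsection \<open>Convolutions of logarithmically decaying sequences\<close>

text \<open>Inclusion and exclusion yields the existence of the limits but no usable bounds: for
  sets B of several neighbours the constants stay implicit and enter with alternating signs. The
  bounds therefore use singletons only, and the ratio 4 between them is the number of neighbours.
  The constant pi comes from the Wallis product: the return probability at time 2k is ((2k choose k)
  / 4^k)^2, about 1 / (pi k), so the Green function grows like ln n / pi, and the monotonicity of
  the tail of T_0 allows this growth to be inverted. In a convolution the logarithmic factor is out
  of control where its argument is small; the bound C / k on the other factor is for these terms,
  since summability alone would allow a tail heavier than 1 / ln m. For one neighbour the constant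
  for at least \<open>Suc q\<close> visits is (1/2)^q * pi * (pi/2): q returns, a past avoiding b, a
  future avoiding 0 and b.\<close>

lemma bounded_of_log_limit:
  fixes g :: "nat \<Rightarrow> real"
  assumes "(\<lambda>m. g m * ln (real m)) \<longlonglongrightarrow> \<gamma>"
  obtains K where "K > 0" "\<And>m. \<bar>g m\<bar> \<le> K" "\<And>m. \<bar>g m * ln (real m)\<bar> \<le> K"
    "\<And>m n. 1 \<le> n \<Longrightarrow> n \<le> m\<^sup>2 \<Longrightarrow> \<bar>g m * ln (real n)\<bar> \<le> K"
proof -
  have "Bseq (\<lambda>m. g m * ln (real m))"
    using assms convergentI convergent_imp_Bseq by blast
  then obtain K1 where K1: "K1 > 0" "\<And>m. \<bar>g m * ln (real m)\<bar> \<le> K1"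
    by (auto simp: Bseq_def)
  have "(\<lambda>m. (g m * ln (real m)) * (1 / ln (real m))) \<longlonglongrightarrow> \<gamma> * 0"
    by (intro tendsto_mult assms) real_asymp
  moreover have "eventually (\<lambda>m. (g m * ln (real m)) * (1 / ln (real m)) = g m) sequentially"
    using eventually_gt_at_top[of 1] by eventually_elim simp
  ultimately have "g \<longlonglongrightarrow> 0"
    by (simp add: tendsto_cong)
  then have "Bseq g"
    using convergentI convergent_imp_Bseq by blast
  then obtain K2 where K2: "K2 > 0" "\<And>m. \<bar>g m\<bar> \<le> K2"
    by (auto simp: Bseq_def)
  show ?thesis
  \<comment> \<open>\<open>K2\<close> covers \<open>g\<close> itself and \<open>2 * K1\<close> the
    exchange of logarithms: n \<le> m^2 gives ln n \<le> 2 ln m.\<close>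
  proof (rule that[of "2 * K1 + K2"])
    fix m n :: nat assume "1 \<le> n" "n \<le> m\<^sup>2"
    then have m: "m \<ge> 1" by (cases m) auto
    have "real n \<le> real m ^ 2"
      using \<open>n \<le> m\<^sup>2\<close> by (metis of_nat_le_iff of_nat_power)
    then have "ln (real n) \<le> ln (real m ^ 2)"
      using \<open>1 \<le> n\<close> m by (subst ln_le_cancel_iff) auto
    also have "\<dots> = 2 * ln (real m)"
      using m by (simp add: ln_realpow)
    finally have "\<bar>g m * ln (real n)\<bar> \<le> \<bar>g m\<bar> * (2 * ln (real m))"
      using \<open>1 \<le> n\<close> by (auto simp: abs_mult intro!: mult_left_mono)
    also have "\<dots> = 2 * \<bar>g m * ln (real m)\<bar>"
      using m by (simp add: abs_mult)
    finally show "\<bar>g m * ln (real n)\<bar> \<le> 2 * K1 + K2"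
      using K1(2)[of m] K2 by linarith
  next
    fix m show "\<bar>g m\<bar> \<le> 2 * K1 + K2" "\<bar>g m * ln (real m)\<bar> \<le> 2 * K1 + K2"
      using K1(1) K1(2)[of m] K2(1) K2(2)[of m] by linarith+
  qed (use K1 K2 in auto)
qed

text \<open>Bounds the number of indices k for which m - k is too small for g (m - k) to be compared
  with 1 / ln m.\<close>

lemma card_near_end:
  "card {k. k \<le> m \<and> (m - k)\<^sup>2 < m} \<le> sqrt (real m) + 1"
proof -
  define s where "s = nat \<lfloor>sqrt (real m)\<rfloor>"
  have "{k. k \<le> m \<and> (m - k)\<^sup>2 < m} \<subseteq> {m - s..m}"
  proof
    fix k assume "k \<in> {k. k \<le> m \<and> (m - k)\<^sup>2 < m}"
    then have k: "k \<le> m" "(m - k)\<^sup>2 < m" by auto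
    have "real (m - k) ^ 2 \<le> real m"
      using k(2) by (metis less_imp_le of_nat_le_iff of_nat_power)
    then have "real (m - k) \<le> sqrt (real m)"
      by (simp add: real_le_rsqrt)
    then have "m - k \<le> s"
      unfolding s_def by (simp add: le_nat_floor)
    then show "k \<in> {m - s..m}" using k by auto
  qed
  then have "card {k. k \<le> m \<and> (m - k)\<^sup>2 < m} \<le> card {m - s..m}"
    by (intro card_mono) auto
  also have "\<dots> \<le> s + 1" by simp
  finally have "real (card {k. k \<le> m \<and> (m - k)\<^sup>2 < m}) \<le> real s + 1" by linarith
  also have "real s \<le> sqrt (real m)" by (simp add: s_def)
  finally show ?thesis by simp
qed

text \<open>For m \<le> (m - k)^2 the summand times ln m is dominated by \<open>K * f k\<close>, so
  Tannery's theorem gives the limit of this part. The at most sqrt m + 1 remaining summands have k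
  close to m, so \<open>fC\<close> makes each of them O(ln m / m) and their sum vanishes.\<close>

lemma convolution_log_limit:
  fixes f g :: "nat \<Rightarrow> real"
  assumes f0: "\<And>k. f k \<ge> 0" and fC: "\<And>k. k \<ge> 1 \<Longrightarrow> f k \<le> C / real k"
    and sm: "summable f" and g: "(\<lambda>m. g m * ln (real m)) \<longlonglongrightarrow> \<gamma>"
  shows "(\<lambda>m. (\<Sum>k\<le>m. f k * g (m - k)) * ln (real m)) \<longlonglongrightarrow> suminf f * \<gamma>"
proof -
  obtain K where K: "K > 0" "\<And>m. \<bar>g m\<bar> \<le> K"
    "\<And>m n. 1 \<le> n \<Longrightarrow> n \<le> m\<^sup>2 \<Longrightarrow> \<bar>g m * ln (real n)\<bar> \<le> K"
    using bounded_of_log_limit[OF g] by metis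
  define a where "a k m = (if k \<le> m \<and> m \<le> (m - k)\<^sup>2 then f k * (g (m - k) * ln (real m)) else 0)"
    for k m
  have lim_a: "(\<lambda>m. a k m) \<longlonglongrightarrow> f k * \<gamma>" for k
  proof -
    have "filterlim (\<lambda>m. m - k) sequentially sequentially"
      by (rule filterlim_minus_const_nat_at_top)
    from filterlim_compose[OF g this]
    have "(\<lambda>m. g (m - k) * ln (real (m - k))) \<longlonglongrightarrow> \<gamma>" .
    moreover have "(\<lambda>m. ln (real m) / ln (real m - real k)) \<longlonglongrightarrow> 1"
      by real_asymp
    ultimately have "(\<lambda>m. f k * ((g (m - k) * ln (real (m - k))) * (ln (real m) / ln (real m - real k))))
        \<longlonglongrightarrow> f k * (\<gamma> * 1)"
      by (intro tendsto_intros)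
    moreover have "eventually (\<lambda>m. real m \<le> (real m - real k)^2) sequentially"
      by real_asymp
    then have "eventually (\<lambda>m. f k * ((g (m - k) * ln (real (m - k))) * (ln (real m) / ln (real m - real k)))
        = a k m) sequentially"
      using eventually_gt_at_top[of "k + 2"]
    proof eventually_elim
      case (elim m)
      then have "real m \<le> real ((m - k)\<^sup>2)" by (simp add: of_nat_diff)
      then have "m \<le> (m - k)\<^sup>2" by linarith
      moreover have "ln (real m - real k) \<noteq> 0"
        using elim by (simp add: ln_eq_zero_iff)
      ultimately show ?case
        using elim by (auto simp: a_def of_nat_diff)
    qed
    ultimately show ?thesis by (simp add: tendsto_cong)
  qed
  have bound_a: "norm (a k m) \<le> K * f k" for k m
  proof (cases "k \<le> m \<and> m \<le> (m - k)\<^sup>2 \<and> 1 \<le> m")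
    case True
    then have "\<bar>g (m - k) * ln (real m)\<bar> \<le> K" using K(3) by blast
    then have "f k * \<bar>g (m - k) * ln (real m)\<bar> \<le> f k * K"
      using f0 by (intro mult_left_mono) auto
    then show ?thesis using f0[of k] True by (simp add: a_def abs_mult mult_ac)
  next
    case False
    \<comment> \<open>The case m = 0 rests on the convention ln 0 = 0.\<close>
    then have "a k m = 0" by (cases m) (auto simp: a_def)
    then show ?thesis using f0[of k] K(1) by simp
  qed
  have "(\<lambda>m. suminf (\<lambda>k. a k m)) \<longlonglongrightarrow> suminf (\<lambda>k. f k * \<gamma>)"
    using tannerys_theorem[of a "\<lambda>k. f k * \<gamma>" sequentially "\<lambda>k. K * f k", OF lim_a
        always_eventually summable_mult[OF sm]] bound_a by simp
  also have "suminf (\<lambda>k. f k * \<gamma>) = suminf f * \<gamma>"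
    using suminf_mult2[OF sm, of \<gamma>] by simp
  finally have main: "(\<lambda>m. suminf (\<lambda>k. a k m)) \<longlonglongrightarrow> suminf f * \<gamma>" .
  define R where "R m = (\<Sum>k | k \<le> m \<and> (m - k)\<^sup>2 < m. f k * g (m - k) * ln (real m))" for m
  have split: "(\<Sum>k\<le>m. f k * g (m - k)) * ln (real m) = suminf (\<lambda>k. a k m) + R m" for m
  proof -
    have "suminf (\<lambda>k. a k m) = (\<Sum>k\<le>m. a k m)"
      by (rule suminf_finite) (simp_all add: a_def)
    also have "\<dots> = (\<Sum>k | k \<le> m \<and> m \<le> (m - k)\<^sup>2. f k * g (m - k) * ln (real m))"
      by (rule sum.mono_neutral_cong_right) (auto simp: a_def)
    finally have 1: "suminf (\<lambda>k. a k m) = (\<Sum>k | k \<le> m \<and> m \<le> (m - k)\<^sup>2. f k * g (m - k) * ln (real m))" .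
    have "{..m} = {k. k \<le> m \<and> m \<le> (m - k)\<^sup>2} \<union> {k. k \<le> m \<and> (m - k)\<^sup>2 < m}"
      by auto
    then have "(\<Sum>k\<le>m. f k * g (m - k) * ln (real m)) = (\<Sum>k | k \<le> m \<and> m \<le> (m - k)\<^sup>2. f k * g (m - k) * ln (real m)) + R m"
      unfolding R_def by (simp only:) (rule sum.union_disjoint, auto)
    then show ?thesis unfolding 1 by (simp add: sum_distrib_right)
  qed
  have C0: "C \<ge> 0" using fC[of 1] f0[of 1] by simp
  have "R \<longlonglongrightarrow> 0"
  proof (rule tendsto_0_le[where K = 1])
    show "(\<lambda>m. (sqrt (real m) + 1) * (C / (real m - sqrt (real m)) * K * ln (real m))) \<longlonglongrightarrow> 0"
      by real_asymp
    show "eventually (\<lambda>m. norm (R m) \<le> norm ((sqrt (real m) + 1) *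
        (C / (real m - sqrt (real m)) * K * ln (real m))) * 1) sequentially"
      using eventually_gt_at_top[of 1]
    proof eventually_elim
      case (elim m)
      have sq: "sqrt (real m) < real m"
        using elim by (intro real_less_lsqrt) (auto simp: power2_eq_square)
      have "norm (R m) \<le> (\<Sum>k | k \<le> m \<and> (m - k)\<^sup>2 < m. \<bar>f k * g (m - k) * ln (real m)\<bar>)"
        unfolding R_def by (simp add: sum_abs)
      also have "\<dots> \<le> of_nat (card {k. k \<le> m \<and> (m - k)\<^sup>2 < m}) *
          (C / (real m - sqrt (real m)) * K * ln (real m))"
      proof (rule sum_bounded_above)
        fix k assume "k \<in> {k. k \<le> m \<and> (m - k)\<^sup>2 < m}"
        then have k: "k \<le> m" "(m - k)\<^sup>2 < m" by auto
        have "real (m - k) ^ 2 \<le> real m"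
          using k(2) by (metis less_imp_le of_nat_le_iff of_nat_power)
        then have "real (m - k) \<le> sqrt (real m)"
          by (simp add: real_le_rsqrt)
        then have kk: "real m - sqrt (real m) \<le> real k"
          using k by (simp add: of_nat_diff)
        then have "k \<ge> 1" using sq by (cases k) auto
        then have "f k \<le> C / real k" by (rule fC)
        also have "\<dots> \<le> C / (real m - sqrt (real m))"
          using kk sq C0 by (intro divide_left_mono) auto
        finally have "f k * \<bar>g (m - k)\<bar> \<le> C / (real m - sqrt (real m)) * K"
          using K f0[of k] by (intro mult_mono) (auto intro: order_trans[OF f0[of k]])
        then have "f k * \<bar>g (m - k)\<bar> * ln (real m) \<le> C / (real m - sqrt (real m)) * K * ln (real m)"
          using elim by (intro mult_right_mono) auto
        then show "\<bar>f k * g (m - k) * ln (real m)\<bar> \<le> C / (real m - sqrt (real m)) * K * ln (real m)"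
          using f0[of k] elim by (simp add: abs_mult)
      qed
      also have "\<dots> \<le> (sqrt (real m) + 1) * (C / (real m - sqrt (real m)) * K * ln (real m))"
        using card_near_end[of m] C0 sq K elim by (intro mult_right_mono) auto
      finally show ?case by (metis mult.right_neutral abs_ge_self order_trans real_norm_def)
    qed
  qed
  with main have "(\<lambda>m. suminf (\<lambda>k. a k m) + R m) \<longlonglongrightarrow> suminf f * \<gamma> + 0"
    by (rule tendsto_add)
  then show ?thesis by (simp add: split)
qed

text \<open>For i between \<delta> n and n the logarithms of i and n differ by at most |ln
  \<delta>|, while w i is O(1 / ln i); hence ln i may be replaced by ln n uniformly in this
  range.\<close>

lemma uniform_log_limit:
  fixes w :: "nat \<Rightarrow> real"
  assumes w: "(\<lambda>i. w i * ln (real i)) \<longlonglongrightarrow> \<alpha>" and \<delta>: "\<delta> > 0" and e: "e > 0"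
  shows "eventually (\<lambda>n. \<forall>i. \<delta> * real n \<le> real i \<and> i \<le> n \<longrightarrow> \<bar>w i * ln (real n) - \<alpha>\<bar> < e) sequentially"
proof -
  have "(\<lambda>i. \<bar>w i * ln (real i) - \<alpha>\<bar> + \<bar>w i * ln (real i)\<bar> * (\<bar>ln \<delta>\<bar> * (1 / ln (real i)))) \<longlonglongrightarrow>
      \<bar>\<alpha> - \<alpha>\<bar> + \<bar>\<alpha>\<bar> * (\<bar>ln \<delta>\<bar> * 0)"
    by (intro tendsto_intros w) real_asymp
  then have "eventually (\<lambda>i. \<bar>w i * ln (real i) - \<alpha>\<bar> + \<bar>w i * ln (real i)\<bar> * (\<bar>ln \<delta>\<bar> * (1 / ln (real i))) < e) sequentially"
    using e by (intro order_tendstoD(2)) auto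
  then obtain N where N: "\<And>i. i \<ge> N \<Longrightarrow>
      \<bar>w i * ln (real i) - \<alpha>\<bar> + \<bar>w i * ln (real i)\<bar> * (\<bar>ln \<delta>\<bar> * (1 / ln (real i))) < e"
    by (auto simp: eventually_sequentially)
  have "eventually (\<lambda>n. \<delta> * real n \<ge> real N + 2) sequentially"
    using \<delta> by real_asymp
  then show ?thesis
    using eventually_gt_at_top[of 0]
  proof eventually_elim
    case (elim n)
    show ?case
    proof (intro allI impI)
      fix i assume i: "\<delta> * real n \<le> real i \<and> i \<le> n"
      then have iN: "i \<ge> N" "i \<ge> 2" using elim by linarith+
      have "ln (\<delta> * real n) \<le> ln (real i)"
        using i elim \<delta> iN by (subst ln_le_cancel_iff) auto
      then have "ln (real n) - ln (real i) \<le> \<bar>ln \<delta>\<bar>"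
        using elim \<delta> by (simp add: ln_mult)
      moreover have "ln (real i) \<le> ln (real n)" using i iN by simp
      ultimately have d: "\<bar>ln (real n) - ln (real i)\<bar> \<le> \<bar>ln \<delta>\<bar>" by linarith
      have "\<bar>w i * ln (real n) - \<alpha>\<bar> = \<bar>(w i * ln (real i) - \<alpha>) + w i * (ln (real n) - ln (real i))\<bar>"
        by (simp add: algebra_simps)
      also have "\<dots> \<le> \<bar>w i * ln (real i) - \<alpha>\<bar> + \<bar>w i\<bar> * \<bar>ln (real n) - ln (real i)\<bar>"
        by (rule order_trans[OF abs_triangle_ineq]) (simp add: abs_mult)
      also have "\<dots> \<le> \<bar>w i * ln (real i) - \<alpha>\<bar> + \<bar>w i\<bar> * \<bar>ln \<delta>\<bar>"
        using d by (intro add_left_mono mult_left_mono) auto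
      also have "\<bar>w i\<bar> * \<bar>ln \<delta>\<bar> = \<bar>w i * ln (real i)\<bar> * (\<bar>ln \<delta>\<bar> * (1 / ln (real i)))"
        using iN by (simp add: abs_mult)
      finally show "\<bar>w i * ln (real n) - \<alpha>\<bar> < e"
        using N[OF iN(1)] by linarith
    qed
  qed
qed


lemma card_lessThan_real:
  assumes "c \<ge> 0"
  shows "(\<Sum>i\<le>n. of_bool (real i < c)) \<le> c + 1"
proof -
  have "{i. i \<le> n \<and> real i < c} \<subseteq> {..nat \<lfloor>c\<rfloor>}"
    by (auto simp: le_nat_floor)
  then have "card {i. i \<le> n \<and> real i < c} \<le> card {..nat \<lfloor>c\<rfloor>}"
    by (intro card_mono) auto
  then have "real (card {i. i \<le> n \<and> real i < c}) \<le> real (nat \<lfloor>c\<rfloor>) + 1"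
    by simp
  also have "\<dots> \<le> c + 1"
    using assms by simp
  finally show ?thesis
    by (simp add: atMost_def Int_def conj_commute flip: of_bool_conj)
qed

lemma card_lessThan_real':
  assumes "c \<ge> 0"
  shows "(\<Sum>i\<le>n. of_bool (real (n - i) < c)) \<le> c + 1"
proof -
  have "(\<Sum>i\<le>n. of_bool (real (n - i) < c)) = (\<Sum>i\<le>n. of_bool (real i < c) :: real)"
    by (rule sum.reindex_bij_witness[where i = "\<lambda>i. n - i" and j = "\<lambda>i. n - i"]) auto
  then show ?thesis using card_lessThan_real[OF assms, of n] by simp
qed

text \<open>Summands with i and n - i both at least \<delta> n are close to \<alpha> \<eta> / (ln
  n)^2. Those whose smaller index lies between sqrt n and \<delta> n are bounded after scaling and
  form a small fraction; the O(sqrt n) others are at most of order (ln n)^2 after scaling, which the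
  division by n absorbs.\<close>

lemma log_log_convolution_limit:
  fixes w h :: "nat \<Rightarrow> real"
  assumes w: "(\<lambda>i. w i * ln (real i)) \<longlonglongrightarrow> \<alpha>" and h: "(\<lambda>i. h i * ln (real i)) \<longlonglongrightarrow> \<eta>"
  shows "(\<lambda>n. (\<Sum>i\<le>n. w i * h (n - i)) * ((ln (real n))\<^sup>2 / real n)) \<longlonglongrightarrow> \<alpha> * \<eta>"
proof (rule tendstoI)
  fix e :: real assume e: "e > 0"
  obtain A where A: "A > 0" "\<And>m. \<bar>w m\<bar> \<le> A"
    "\<And>m n. 1 \<le> n \<Longrightarrow> n \<le> m\<^sup>2 \<Longrightarrow> \<bar>w m * ln (real n)\<bar> \<le> A"
    using bounded_of_log_limit[OF w] by metis
  obtain B where B: "B > 0" "\<And>m. \<bar>h m\<bar> \<le> B"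
    "\<And>m n. 1 \<le> n \<Longrightarrow> n \<le> m\<^sup>2 \<Longrightarrow> \<bar>h m * ln (real n)\<bar> \<le> B"
    using bounded_of_log_limit[OF h] by metis
  define c where "c = \<alpha> * \<eta>"
  define K where "K = A * B + \<bar>c\<bar>"
  \<comment> \<open>Two strips of about \<delta> n indices with error at most K each cost 2 K
    \<delta> = e / 2 after division by n; the bulk costs e / 4, which leaves a margin of e /
    4.\<close>
  define \<delta> where "\<delta> = e / (4 * K)"
  \<comment> \<open>The cap 1 gives |y| \<le> |\<eta>| + 1 for the factor near \<eta>; the other
    term keeps the bulk error below e / 4.\<close>
  define e1 where "e1 = min 1 (e / (4 * (\<bar>\<eta>\<bar> + 1 + \<bar>\<alpha>\<bar>)))"
  define Z where "Z n = A * B * (ln (real n))\<^sup>2 + \<bar>c\<bar>" for n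
  have K: "K > 0" using A B by (simp add: K_def add_pos_nonneg)
  have \<delta>: "\<delta> > 0" using K e by (simp add: \<delta>_def)
  have e1: "e1 > 0" "e1 \<le> 1" "e1 * (\<bar>\<eta>\<bar> + 1 + \<bar>\<alpha>\<bar>) \<le> e / 4"
  proof -
    have "e1 * (\<bar>\<eta>\<bar> + 1 + \<bar>\<alpha>\<bar>) \<le> e / (4 * (\<bar>\<eta>\<bar> + 1 + \<bar>\<alpha>\<bar>)) * (\<bar>\<eta>\<bar> + 1 + \<bar>\<alpha>\<bar>)"
      by (intro mult_right_mono) (auto simp: e1_def)
    also have "\<dots> = e / 4"
    proof -
      have "x \<noteq> 0 \<Longrightarrow> e / (4 * x) * x = e / 4" for x by simp
      then show ?thesis by (metis abs_ge_zero add_nonneg_pos add_pos_nonneg less_irrefl zero_less_one)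
    qed
    finally show "e1 * (\<bar>\<eta>\<bar> + 1 + \<bar>\<alpha>\<bar>) \<le> e / 4" .
  qed (use e in \<open>auto simp: e1_def\<close>)
  \<comment> \<open>Total error over n: the bulk, the strips below \<delta> n, the strips below sqrt
    n, and |c| because n + 1 summands are compared with n * c.\<close>
  define Q where "Q n = ((real n + 1) * (e / 4) + K * (2 * (\<delta> * real n + 1)) +
      Z n * (2 * (sqrt (real n) + 1)) + \<bar>c\<bar>) / real n" for n
  have "Q \<longlonglongrightarrow> e / 4 + 2 * (K * \<delta>)"
    unfolding Q_def Z_def by real_asymp
  moreover have "e / 4 + 2 * (K * \<delta>) < e" using e K by (simp add: \<delta>_def)
  ultimately have "eventually (\<lambda>n. Q n < e) sequentially"
    by (rule order_tendstoD)
  moreover note uniform_log_limit[OF w \<delta> e1(1)] uniform_log_limit[OF h \<delta> e1(1)]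
  ultimately show "eventually (\<lambda>n. dist ((\<Sum>i\<le>n. w i * h (n - i)) * ((ln (real n))\<^sup>2 / real n)) (\<alpha> * \<eta>) < e) sequentially"
    using eventually_gt_at_top[of 0]
  proof eventually_elim
    case (elim n)
    define t where "t i = (w i * ln (real n)) * (h (n - i) * ln (real n))" for i
    have Z0: "Z n \<ge> 0" using A B by (simp add: Z_def)
    have pt: "\<bar>t i - c\<bar> \<le> e / 4 + K * (of_bool (real i < \<delta> * real n) + of_bool (real (n - i) < \<delta> * real n))
        + Z n * (of_bool (real i < sqrt (real n)) + of_bool (real (n - i) < sqrt (real n)))"
      if i: "i \<le> n" for i
    proof -
      have sq: "n \<le> j\<^sup>2" if "\<not> real j < sqrt (real n)" for j
      proof -
        have "sqrt (real n) ^ 2 \<le> real j ^ 2" using that by (intro power_mono) auto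
        then have "real n \<le> real (j\<^sup>2)" by simp
        then show ?thesis by linarith
      qed
      consider (bad) "real i < sqrt (real n) \<or> real (n - i) < sqrt (real n)"
        | (good) "\<not> real i < sqrt (real n)" "\<not> real (n - i) < sqrt (real n)"
            "real i < \<delta> * real n \<or> real (n - i) < \<delta> * real n"
        | (mid) "\<not> real i < \<delta> * real n" "\<not> real (n - i) < \<delta> * real n"
        by blast
      then show ?thesis
      proof cases
        case bad
        have "\<bar>t i\<bar> = (\<bar>w i\<bar> * \<bar>h (n - i)\<bar>) * (ln (real n))\<^sup>2"
          by (simp add: t_def abs_mult power2_eq_square mult_ac)
        also have "\<dots> \<le> (A * B) * (ln (real n))\<^sup>2"
          using A B by (intro mult_right_mono mult_mono) auto
        finally have "\<bar>t i - c\<bar> \<le> Z n" unfolding Z_def by linarith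
        also have "\<dots> \<le> Z n * (of_bool (real i < sqrt (real n)) + of_bool (real (n - i) < sqrt (real n)))"
          using bad Z0 by (auto simp: of_bool_def)
        moreover have "K * (of_bool (real i < \<delta> * real n) + of_bool (real (n - i) < \<delta> * real n)) \<ge> 0"
          using K by simp
        ultimately show ?thesis using e by linarith
      next
        case good
        have "\<bar>t i\<bar> \<le> A * B"
          unfolding t_def abs_mult[of "w i * ln (real n)"] using A B elim(4) sq good
          by (intro mult_mono) auto
        then have "\<bar>t i - c\<bar> \<le> K" unfolding K_def by linarith
        also have "\<dots> \<le> K * (of_bool (real i < \<delta> * real n) + of_bool (real (n - i) < \<delta> * real n))"
          using good K by (auto simp: of_bool_def)
        moreover have "Z n * (of_bool (real i < sqrt (real n)) + of_bool (real (n - i) < sqrt (real n))) \<ge> 0"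
          using Z0 by simp
        ultimately show ?thesis using e by linarith
      next
        case mid
        define x where "x = w i * ln (real n)"
        define y where "y = h (n - i) * ln (real n)"
        have x: "\<bar>x - \<alpha>\<bar> < e1" and y: "\<bar>y - \<eta>\<bar> < e1"
          using elim(2,3) mid i by (auto simp: x_def y_def)
        have "\<bar>t i - c\<bar> = \<bar>(x - \<alpha>) * y + \<alpha> * (y - \<eta>)\<bar>"
          by (simp add: t_def c_def x_def y_def algebra_simps)
        also have "\<dots> \<le> \<bar>x - \<alpha>\<bar> * \<bar>y\<bar> + \<bar>\<alpha>\<bar> * \<bar>y - \<eta>\<bar>"
          by (rule order_trans[OF abs_triangle_ineq]) (simp add: abs_mult)
        also have "\<dots> \<le> e1 * (\<bar>\<eta>\<bar> + 1) + \<bar>\<alpha>\<bar> * e1"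
          using x y e1 by (intro add_mono mult_mono) auto
        also have "\<dots> = e1 * (\<bar>\<eta>\<bar> + 1 + \<bar>\<alpha>\<bar>)" by (simp add: algebra_simps)
        also have "\<dots> \<le> e / 4" by (rule e1)
        finally show ?thesis using K Z0 by (simp add: add_increasing2)
      qed
    qed
    have "\<bar>(\<Sum>i\<le>n. t i) - (real n + 1) * c\<bar> = \<bar>\<Sum>i\<le>n. (t i - c)\<bar>"
      by (simp add: sum_subtractf algebra_simps)
    also have "\<dots> \<le> (\<Sum>i\<le>n. \<bar>t i - c\<bar>)" by (rule sum_abs)
    also have "\<dots> \<le> (\<Sum>i\<le>n. e / 4 + K * (of_bool (real i < \<delta> * real n) + of_bool (real (n - i) < \<delta> * real n))
        + Z n * (of_bool (real i < sqrt (real n)) + of_bool (real (n - i) < sqrt (real n))))"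
      by (intro sum_mono pt) auto
    also have "\<dots> = (real n + 1) * (e / 4)
        + K * ((\<Sum>i\<le>n. of_bool (real i < \<delta> * real n)) + (\<Sum>i\<le>n. of_bool (real (n - i) < \<delta> * real n)))
        + Z n * ((\<Sum>i\<le>n. of_bool (real i < sqrt (real n))) + (\<Sum>i\<le>n. of_bool (real (n - i) < sqrt (real n))))"
      by (simp only: sum.distrib sum_distrib_left[symmetric] sum_constant card_atMost) simp
    also have "\<dots> \<le> (real n + 1) * (e / 4) + K * ((\<delta> * real n + 1) + (\<delta> * real n + 1))
        + Z n * ((sqrt (real n) + 1) + (sqrt (real n) + 1))"
      using K Z0 \<delta> by (intro add_mono mult_left_mono card_lessThan_real card_lessThan_real') auto
    finally have main: "\<bar>(\<Sum>i\<le>n. t i) - (real n + 1) * c\<bar> + \<bar>c\<bar> \<le> Q n * real n"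
      using elim(4) by (simp add: Q_def)
    have "(\<Sum>i\<le>n. w i * h (n - i)) * (ln (real n))\<^sup>2 = (\<Sum>i\<le>n. t i)"
      unfolding t_def sum_distrib_right by (intro sum.cong) (auto simp: power2_eq_square)
    then have "(\<Sum>i\<le>n. w i * h (n - i)) * ((ln (real n))\<^sup>2 / real n) - c
        = ((\<Sum>i\<le>n. t i) - real n * c) / real n"
      using elim(4) by (simp add: diff_divide_distrib)
    then have "dist ((\<Sum>i\<le>n. w i * h (n - i)) * ((ln (real n))\<^sup>2 / real n)) (\<alpha> * \<eta>)
        = \<bar>(\<Sum>i\<le>n. t i) - real n * c\<bar> / real n"
      by (simp add: dist_real_def c_def)
    also have "\<dots> \<le> (\<bar>(\<Sum>i\<le>n. t i) - (real n + 1) * c\<bar> + \<bar>c\<bar>) / real n"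
      by (intro divide_right_mono) (auto simp: algebra_simps)
    also have "\<dots> \<le> Q n" using main elim(4) by (simp add: field_simps)
    also have "\<dots> < e" by (rule elim)
    finally show ?case .
  qed
qed

section \<open>Harmonic sums and a renewal equation with logarithmic growth\<close>

lemma sum_harmonic_asymp:
  fixes a :: "nat \<Rightarrow> real"
  assumes a: "(\<lambda>k. a k * real k) \<longlonglongrightarrow> l"
  shows "(\<lambda>n. (\<Sum>k=1..n. a k) / ln (real n)) \<longlonglongrightarrow> l"
proof (rule tendstoI)
  fix e :: real assume e: "e > 0"
  obtain N where N: "\<And>k. k \<ge> N \<Longrightarrow> \<bar>a k * real k - l\<bar> < e / 2"
    using LIMSEQ_D[OF a, of "e / 2"] e by auto
  \<comment> \<open>\<open>C\<close> absorbs the finitely many terms up to N; the later ones are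
    within e / (2 k) of l / k and are compared with the harmonic numbers.\<close>
  define C where "C = (\<Sum>k=1..N. \<bar>a k - l / real k\<bar>)"
  have harm: "(\<lambda>n. harm n / ln (real n)) \<longlonglongrightarrow> (1::real)"
  proof -
    have "(\<lambda>n. (harm n - ln (real n)) * (1 / ln (real n)) + ln (real n) / ln (real n))
        \<longlonglongrightarrow> euler_mascheroni * 0 + (1::real)"
      by (intro tendsto_intros euler_mascheroni_LIMSEQ) real_asymp+
    moreover have "eventually (\<lambda>n. (harm n - ln (real n)) * (1 / ln (real n)) + ln (real n) / ln (real n)
        = harm n / ln (real n)) sequentially"
      using eventually_gt_at_top[of 1] by eventually_elim (simp add: field_simps)
    ultimately show ?thesis by (simp add: tendsto_cong)
  qed
  have "(\<lambda>n. C * (1 / ln (real n)) + e / 2 * (harm n / ln (real n)) + \<bar>l\<bar> * \<bar>harm n / ln (real n) - 1\<bar>)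
      \<longlonglongrightarrow> C * 0 + e / 2 * 1 + \<bar>l\<bar> * \<bar>1 - 1\<bar>"
    by (intro tendsto_intros harm) real_asymp
  from order_tendstoD(2)[OF this, of e] have "eventually (\<lambda>n. C * (1 / ln (real n)) + e / 2 * (harm n / ln (real n)) + \<bar>l\<bar> * \<bar>harm n / ln (real n) - 1\<bar> < e) sequentially"
    using e by simp
  then show "eventually (\<lambda>n. dist ((\<Sum>k=1..n. a k) / ln (real n)) l < e) sequentially"
    using eventually_gt_at_top[of 1]
  proof eventually_elim
    case (elim n)
    have ln: "ln (real n) > 0" using elim by simp
    have "\<bar>(\<Sum>k=1..n. a k) - l * harm n\<bar> = \<bar>\<Sum>k=1..n. (a k - l / real k)\<bar>"
      by (simp add: harm_def sum_subtractf sum_distrib_left divide_inverse)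
    also have "\<dots> \<le> (\<Sum>k=1..n. \<bar>a k - l / real k\<bar>)" by (rule sum_abs)
    also have "\<dots> \<le> (\<Sum>k=1..n. (if k \<le> N then \<bar>a k - l / real k\<bar> else 0) + e / 2 * inverse (real k))"
    proof (rule sum_mono)
      fix k assume k: "k \<in> {1..n}"
      show "\<bar>a k - l / real k\<bar> \<le> (if k \<le> N then \<bar>a k - l / real k\<bar> else 0) + e / 2 * inverse (real k)"
      proof (cases "k \<le> N")
        case False
        have "a k - l / real k = (a k * real k - l) * inverse (real k)"
          using k by (simp add: field_simps)
        then have "\<bar>a k - l / real k\<bar> = \<bar>a k * real k - l\<bar> * inverse (real k)"
          by (simp add: abs_mult)
        also have "\<dots> \<le> e / 2 * inverse (real k)"
          using N[of k] False by (intro mult_right_mono) auto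
        finally show ?thesis using False by simp
      qed (use e in auto)
    qed
    also have "\<dots> = (\<Sum>k=1..n. (if k \<le> N then \<bar>a k - l / real k\<bar> else 0)) + e / 2 * harm n"
      by (simp add: sum.distrib harm_def sum_distrib_left)
    also have "(\<Sum>k=1..n. (if k \<le> N then \<bar>a k - l / real k\<bar> else 0)) \<le> C"
      unfolding C_def sum.inter_filter[symmetric, OF finite_atLeastAtMost]
      by (rule sum_mono2) auto
    finally have 1: "\<bar>(\<Sum>k=1..n. a k) - l * harm n\<bar> \<le> C + e / 2 * harm n" by simp
    have "(\<Sum>k=1..n. a k) / ln (real n) - l = ((\<Sum>k=1..n. a k) - l * harm n) / ln (real n)
        + l * (harm n / ln (real n) - 1)"
      using ln by (simp add: field_simps)
    then have "dist ((\<Sum>k=1..n. a k) / ln (real n)) l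
        \<le> \<bar>(\<Sum>k=1..n. a k) - l * harm n\<bar> / ln (real n) + \<bar>l\<bar> * \<bar>harm n / ln (real n) - 1\<bar>"
      using ln abs_triangle_ineq[of "((\<Sum>k=1..n. a k) - l * harm n) / ln (real n)"
        "l * (harm n / ln (real n) - 1)"] by (simp only: dist_real_def abs_mult abs_divide abs_of_pos)
    also have "\<dots> \<le> (C + e / 2 * harm n) / ln (real n) + \<bar>l\<bar> * \<bar>harm n / ln (real n) - 1\<bar>"
      using 1 ln by (intro add_right_mono divide_right_mono) auto
    also have "\<dots> < e" using elim(1) by (simp add: add_divide_distrib)
    finally show ?case .
  qed
qed

text \<open>Monotonicity bounds every \<open>r (n - k)\<close> below by \<open>r n\<close>, so r n
  \<le> 1 / G n. For the converse the renewal sum up to n + j is cut at n: the first part is at most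
  r j * G n, the remaining j summands are at most C / n each.\<close>

lemma renewal_tail_log_limit:
  fixes p r :: "nat \<Rightarrow> real"
  assumes p0: "p 0 > 0" "\<And>k. p k \<ge> 0" and pC: "\<And>k. k \<ge> 1 \<Longrightarrow> p k \<le> C / real k"
    and r: "\<And>m. 0 \<le> r m" "\<And>m. r m \<le> 1" "\<And>m n. m \<le> n \<Longrightarrow> r n \<le> r m"
    and renewal: "\<And>n. (\<Sum>k\<le>n. p k * r (n - k)) = 1"
    and G: "(\<lambda>n. (\<Sum>k\<le>n. p k) / ln (real n)) \<longlonglongrightarrow> l" and l: "l > 0"
  shows "(\<lambda>n. r n * ln (real n)) \<longlonglongrightarrow> 1 / l"
proof -
  define G where "G n = (\<Sum>k\<le>n. p k)" for n
  have Gpos: "G n > 0" for n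
  proof -
    have "p 0 \<le> G n" unfolding G_def using p0 by (intro member_le_sum) auto
    with p0 show ?thesis by linarith
  qed
  have Glim: "(\<lambda>n. ln (real n) / G n) \<longlonglongrightarrow> 1 / l"
    using tendsto_divide[OF tendsto_const[of 1] G] l by (simp add: G_def)
  have C0: "C \<ge> 0" using pC[of 1] p0(2)[of 1] by simp
  have up: "r n \<le> 1 / G n" for n
  proof -
    have "r n * G n = (\<Sum>k\<le>n. p k * r n)" by (simp add: G_def sum_distrib_left mult_ac)
    also have "\<dots> \<le> (\<Sum>k\<le>n. p k * r (n - k))"
      using p0 r by (intro sum_mono mult_left_mono) auto
    finally show ?thesis using renewal[of n] Gpos[of n] by (simp add: field_simps)
  qed
  have low: "1 \<le> r j * G n + real j * (C / real n)" if "n \<ge> 1" for j n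
  proof -
    have "1 = (\<Sum>k\<le>n+j. p k * r (n + j - k))" by (simp add: renewal)
    also have "{..n+j} = {..n} \<union> {n<..n+j}" by auto
    also have "(\<Sum>k\<in>{..n} \<union> {n<..n+j}. p k * r (n + j - k)) =
        (\<Sum>k\<le>n. p k * r (n + j - k)) + (\<Sum>k\<in>{n<..n+j}. p k * r (n + j - k))"
      by (rule sum.union_disjoint) auto
    also have "(\<Sum>k\<le>n. p k * r (n + j - k)) \<le> (\<Sum>k\<le>n. p k * r j)"
      using p0 r by (intro sum_mono mult_left_mono) auto
    also have "(\<Sum>k\<in>{n<..n+j}. p k * r (n + j - k)) \<le> of_nat (card {n<..n+j}) * (C / real n)"
    proof (rule sum_bounded_above)
      fix k assume k: "k \<in> {n<..n+j}"
      have "p k * r (n + j - k) \<le> p k * 1" using p0 r by (intro mult_left_mono) auto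
      also have "\<dots> \<le> C / real k" using pC[of k] k by simp
      also have "\<dots> \<le> C / real n" using k C0 that by (intro divide_left_mono) auto
      finally show "p k * r (n + j - k) \<le> C / real n" .
    qed
    finally show ?thesis by (simp add: G_def sum_distrib_left mult_ac)
  qed
  \<comment> \<open>The factor of order ln j is large enough to make C j / N vanish and small enough
    to keep ln N asymptotic to ln j.\<close>
  define N where "N j = j * nat \<lceil>ln (real j)\<rceil>" for j
  have N: "filterlim N at_top sequentially"
    unfolding N_def by real_asymp
  have "(\<lambda>j. (ln (real j) / ln (real (N j))) * (ln (real (N j)) / G (N j)) * (1 - C * (real j / real (N j))))
      \<longlonglongrightarrow> 1 * (1 / l) * (1 - C * 0)"
  proof (intro tendsto_mult tendsto_diff tendsto_const filterlim_compose[OF Glim N])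
    show "(\<lambda>j. ln (real j) / ln (real (N j))) \<longlonglongrightarrow> 1" unfolding N_def by real_asymp
    show "(\<lambda>j. real j / real (N j)) \<longlonglongrightarrow> 0" unfolding N_def by real_asymp
  qed
  then have lower: "(\<lambda>j. (ln (real j) / ln (real (N j))) * (ln (real (N j)) / G (N j)) * (1 - C * (real j / real (N j))))
      \<longlonglongrightarrow> 1 / l" by simp
  show ?thesis
  proof (rule tendsto_sandwich[OF _ _ lower Glim])
    show "eventually (\<lambda>n. r n * ln (real n) \<le> ln (real n) / G n) sequentially"
      using eventually_gt_at_top[of 0]
    proof eventually_elim
      case (elim n)
      then show ?case using mult_right_mono[OF up[of n], of "ln (real n)"] by simp
    qed
    have "eventually (\<lambda>j. N j > 1) sequentially"
      using N eventually_gt_at_top[of 1] by (rule eventually_compose_filterlim[rotated])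
    then show "eventually (\<lambda>j. (ln (real j) / ln (real (N j))) * (ln (real (N j)) / G (N j)) * (1 - C * (real j / real (N j)))
        \<le> r j * ln (real j)) sequentially"
      using eventually_gt_at_top[of 0]
    proof eventually_elim
      case (elim j)
      have "1 - C * (real j / real (N j)) \<le> r j * G (N j)"
        using low[of "N j" j] elim by (simp add: mult_ac)
      then have "(1 - C * (real j / real (N j))) / G (N j) \<le> r j"
        using Gpos[of "N j"] by (simp add: field_simps)
      then have "ln (real j) * ((1 - C * (real j / real (N j))) / G (N j)) \<le> ln (real j) * r j"
        using elim by (intro mult_left_mono) auto
      moreover have "ln (real (N j)) \<noteq> 0" using elim by simp
      ultimately show ?case by (simp add: mult_ac)
    qed
  qed
qed

subsection \<open>Averages over lattice paths\<close>

definition paths :: "nat \<Rightarrow> (int \<times> int) list set" where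
  "paths n = {v. set v \<subseteq> nbrs 0 \<and> length v = n}"

text \<open>Expectation under the uniform law on the 4^n step lists. The estimates are done with
  these averages; \<open>expectation_steps\<close> carries them over to the probability
  space.\<close>

definition avg :: "nat \<Rightarrow> ((int \<times> int) list \<Rightarrow> real) \<Rightarrow> real" where
  "avg n \<phi> = (\<Sum>v\<in>paths n. \<phi> v) / 4 ^ n"

abbreviation Pr :: "nat \<Rightarrow> ((int \<times> int) list \<Rightarrow> bool) \<Rightarrow> real" where
  "Pr n P \<equiv> avg n (\<lambda>v. of_bool (P v))"

definition pos :: "(int \<times> int) list \<Rightarrow> nat \<Rightarrow> int \<times> int" where
  "pos v j = sum_list (take j v)"

text \<open>Time 0 is excluded, so that \<open>avoids {0}\<close> says that the walk does not return
  to its start.\<close>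

definition avoids :: "(int \<times> int) set \<Rightarrow> (int \<times> int) list \<Rightarrow> bool" where
  "avoids D v \<longleftrightarrow> (\<forall>j\<in>{1..length v}. pos v j \<notin> D)"

text \<open>For d in D this is the event that the first entrance into D after time 0 happens at the
  final time, at the point d. The empty list is excluded because its end point 0 would otherwise
  count as an entrance.\<close>

definition hits :: "(int \<times> int) set \<Rightarrow> int \<times> int \<Rightarrow> (int \<times> int) list \<Rightarrow> bool" where
  "hits D d v \<longleftrightarrow> v \<noteq> [] \<and> pos v (length v) = d \<and> (\<forall>j\<in>{1..<length v}. pos v j \<notin> D)"

definition returns :: "(int \<times> int) list \<Rightarrow> nat" where
  "returns v = card {j\<in>{1..length v}. pos v j = 0}"

lemma nbrs_0: "nbrs 0 = {(1, 0), (-1, 0), (0, 1), (0, -1)}"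
  using nbrs_explicit[of 0 0] by (simp add: zero_prod_def)

lemma finite_nbrs_0 [simp]: "finite (nbrs 0)" and card_nbrs_0: "card (nbrs 0) = 4"
  and zero_notin_nbrs_0 [simp]: "0 \<notin> nbrs 0"
  unfolding nbrs_0 by (simp_all add: zero_prod_def)

lemma nbrs_add: "nbrs x = (+) x ` nbrs 0"
  by (cases x) (auto simp: nbrs_explicit nbrs_0)

lemma uminus_nbrs_0 [simp]: "- e \<in> nbrs 0 \<longleftrightarrow> e \<in> nbrs 0"
  by (cases e) (auto simp: nbrs_0)

lemma finite_paths [simp]: "finite (paths n)"
  unfolding paths_def by (rule finite_lists_length_eq) simp

lemma card_paths: "card (paths n) = 4 ^ n"
  unfolding paths_def by (subst card_lists_length_eq) (simp_all add: card_nbrs_0)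

lemma length_paths [dest]: "v \<in> paths n \<Longrightarrow> length v = n"
  by (simp add: paths_def)

lemma avg_cong: "(\<And>v. v \<in> paths n \<Longrightarrow> \<phi> v = \<psi> v) \<Longrightarrow> avg n \<phi> = avg n \<psi>"
  unfolding avg_def by (simp cong: sum.cong)

lemma avg_mono: "(\<And>v. v \<in> paths n \<Longrightarrow> \<phi> v \<le> \<psi> v) \<Longrightarrow> avg n \<phi> \<le> avg n \<psi>"
  unfolding avg_def by (intro divide_right_mono sum_mono) auto

lemma avg_const [simp]: "avg n (\<lambda>_. c) = c"
  by (simp add: avg_def card_paths)

lemma avg_add: "avg n (\<lambda>v. \<phi> v + \<psi> v) = avg n \<phi> + avg n \<psi>"
  by (simp add: avg_def sum.distrib add_divide_distrib)

lemma avg_diff: "avg n (\<lambda>v. \<phi> v - \<psi> v) = avg n \<phi> - avg n \<psi>"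
  by (simp add: avg_def sum_subtractf diff_divide_distrib)

lemma avg_cmult: "avg n (\<lambda>v. c * \<phi> v) = c * avg n \<phi>"
  by (simp add: avg_def sum_distrib_left)

lemma avg_mult_const: "avg n (\<lambda>v. \<phi> v * c) = avg n \<phi> * c"
  using avg_cmult[of n c \<phi>] by (simp add: mult_ac)

lemma avg_sum: "avg n (\<lambda>v. \<Sum>i\<in>I. \<phi> i v) = (\<Sum>i\<in>I. avg n (\<phi> i))"
  unfolding avg_def by (subst sum.swap) (simp add: sum_divide_distrib)

lemma Pr_nonneg: "0 \<le> Pr n P" and Pr_le_1: "Pr n P \<le> 1"
  using avg_mono[of n "\<lambda>_. 0" "\<lambda>v. of_bool (P v)"] avg_mono[of n "\<lambda>v. of_bool (P v)" "\<lambda>_. 1"]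
  by simp_all

lemma Pr_mono: "(\<And>v. v \<in> paths n \<Longrightarrow> P v \<Longrightarrow> Q v) \<Longrightarrow> Pr n P \<le> Pr n Q"
  by (rule avg_mono) auto

lemma avg_0 [simp]: "avg 0 \<phi> = \<phi> []"
proof -
  have "paths 0 = {[]}" by (auto simp: paths_def)
  then show ?thesis by (simp add: avg_def)
qed

lemma avg_append: "avg (i + j) \<phi> = avg i (\<lambda>u. avg j (\<lambda>v. \<phi> (u @ v)))"
proof -
  have "(\<Sum>w\<in>paths (i + j). \<phi> w) = (\<Sum>(u, v)\<in>paths i \<times> paths j. \<phi> (u @ v))"
    by (rule sum.reindex_bij_witness[where i = "\<lambda>(u, v). u @ v" and j = "\<lambda>w. (take i w, drop i w)"])
      (auto simp: paths_def dest: in_set_takeD in_set_dropD)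
  then show ?thesis
    by (simp add: avg_def sum.cartesian_product[symmetric] sum_divide_distrib power_add mult_ac)
qed

text \<open>Markov property in counting form: the first i steps and the later ones are independent,
  and the later ones again form a uniform step list.\<close>

lemma avg_split:
  assumes "i \<le> n"
  shows "avg n (\<lambda>v. \<phi> (take i v) * \<psi> (drop i v)) = avg i \<phi> * avg (n - i) \<psi>"
proof -
  have "avg (i + (n - i)) (\<lambda>v. \<phi> (take i v) * \<psi> (drop i v))
      = avg i (\<lambda>u. avg (n - i) (\<lambda>v. \<phi> u * \<psi> v))"
    unfolding avg_append by (intro avg_cong) (auto dest!: length_paths)
  then show ?thesis using assms by (simp add: avg_cmult avg_mult_const)
qed

lemma avg_1: "avg (Suc 0) \<phi> = (\<Sum>e\<in>nbrs 0. \<phi> [e]) / 4"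
proof -
  have "(\<Sum>v\<in>paths (Suc 0). \<phi> v) = (\<Sum>e\<in>nbrs 0. \<phi> [e])"
    by (rule sum.reindex_bij_witness[where j = hd and i = "\<lambda>e. [e]"])
      (auto simp: paths_def length_Suc_conv)
  then show ?thesis by (simp add: avg_def)
qed

lemma avg_Suc: "avg (Suc n) \<phi> = (\<Sum>e\<in>nbrs 0. avg n (\<lambda>v. \<phi> (e # v))) / 4"
  using avg_append[of 1 n \<phi>] by (simp add: avg_1)

text \<open>By \<open>pos_reverse\<close> the new list is the path run backwards and seen from its
  end point. It ranges over the same lists because the step set is symmetric.\<close>

lemma avg_reverse: "avg n (\<lambda>v. \<phi> (rev (map uminus v))) = avg n \<phi>"
proof -
  have sub: "uminus ` set v \<subseteq> nbrs 0 \<longleftrightarrow> set v \<subseteq> nbrs 0" for v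
    unfolding image_subset_iff uminus_nbrs_0 by blast
  have "(\<Sum>v\<in>paths n. \<phi> (rev (map uminus v))) = (\<Sum>v\<in>paths n. \<phi> v)"
    by (rule sum.reindex_bij_witness[where i = "\<lambda>v. rev (map uminus v)" and j = "\<lambda>v. rev (map uminus v)"])
      (simp_all add: paths_def rev_map o_def sub)
  then show ?thesis by (simp add: avg_def)
qed

lemma avg_map:
  assumes "bij_betw A (nbrs 0) (nbrs 0)"
  shows "avg n (\<lambda>v. \<phi> (map A v)) = avg n \<phi>"
proof -
  have inj: "inj_on (map A) (paths n)"
    using assms by (auto simp: paths_def bij_betw_def intro!: inj_on_mapI inj_on_subset[of A "nbrs 0"])
  have "map A ` paths n = paths n"
  proof (rule endo_inj_surj)
    have "set (map A v) \<subseteq> nbrs 0" if "set v \<subseteq> nbrs 0" for v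
      using assms that unfolding bij_betw_def by (simp only: set_map image_mono)  blast
    then show "map A ` paths n \<subseteq> paths n"
      unfolding paths_def by (auto simp only: length_map)
  qed (simp_all add: inj)
  then have "(\<Sum>v\<in>paths n. \<phi> (map A v)) = (\<Sum>v\<in>paths n. \<phi> v)"
    using sum.reindex[OF inj, of \<phi>] by simp
  then show ?thesis by (simp add: avg_def)
qed

section \<open>Positions and rotations of the lattice\<close>

lemma pos_0 [simp]: "pos v 0 = 0"
  by (simp add: pos_def)

lemma pos_Cons_Suc [simp]: "pos (e # v) (Suc j) = e + pos v j"
  by (simp add: pos_def)

lemma pos_take [simp]: "pos (take k v) j = pos v (min j k)"
  by (simp add: pos_def)

lemma pos_drop: "pos (drop k v) j = pos v (k + j) - pos v k"
proof -
  have "take (k + j) v = take k v @ take j (drop k v)" by (rule take_add)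
  then show ?thesis by (simp add: pos_def)
qed

lemma pos_map:
  assumes "\<And>x y. A (x + y) = A x + A y" "A 0 = 0"
  shows "pos (map A v) j = A (pos v j)"
proof -
  have "sum_list (map A u) = A (sum_list u)" for u
    by (induction u) (simp_all add: assms)
  then show ?thesis by (simp add: pos_def take_map)
qed

lemma pos_reverse:
  assumes "j \<le> length v"
  shows "pos (rev (map uminus v)) j = pos v (length v - j) - pos v (length v)"
proof -
  have *: "sum_list (map uminus u) = - sum_list u" for u :: "(int \<times> int) list"
    by (induction u) simp_all
  have "pos (rev (map uminus v)) j = - sum_list (drop (length v - j) v)"
    by (simp add: pos_def take_rev sum_list_rev drop_map * flip: rev_map)
  also have "sum_list (drop (length v - j) v) = pos (drop (length v - j) v) j"
    using assms by (simp add: pos_def)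
  finally show ?thesis using assms by (simp add: pos_drop)
qed

text \<open>Powers of the quarter turn suffice. Additivity is part of the conclusion because
  \<open>pos_map\<close> uses it to carry positions along.\<close>

lemma nbrs_0_transitive:
  assumes "b \<in> nbrs 0" "b' \<in> nbrs 0"
  obtains A where "\<And>x y. A (x + y) = A x + A y" "A 0 = 0" "inj A" "A b = b'"
    "bij_betw A (nbrs 0) (nbrs 0)"
proof -
  define R :: "int \<times> int \<Rightarrow> int \<times> int" where "R = (\<lambda>(x, y). (- y, x))"
  have R: "R (x + y) = R x + R y" "R 0 = 0" "inj R" for x y
    by (auto simp: R_def zero_prod_def inj_def split: prod.splits)
  have bij: "bij_betw R (nbrs 0) (nbrs 0)"
    unfolding nbrs_0 by (auto simp: bij_betw_def inj_on_def R_def)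
  have iter: "(R ^^ k) (x + y) = (R ^^ k) x + (R ^^ k) y \<and> (R ^^ k) 0 = 0" for k x y
    by (induction k) (auto simp: R)
  have "\<exists>k. (R ^^ k) b = b'"
  proof -
    have "(R ^^ 0) b = b' \<or> (R ^^ 1) b = b' \<or> (R ^^ 2) b = b' \<or> (R ^^ 3) b = b'"
      using assms by (auto simp: nbrs_0 R_def eval_nat_numeral)
    then show ?thesis by blast
  qed
  then obtain k where k: "(R ^^ k) b = b'" by blast
  show ?thesis
    by (rule that[of "R ^^ k"])
      (use iter k in \<open>auto intro!: bij_betw_funpow inj_fn R bij\<close>)
qed

text \<open>First step analysis: after a first step e, not returning to 0 means avoiding -e as seen
  from the new position, and all neighbours are equivalent by rotation. The first step explains
  \<open>Suc m\<close>.\<close>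

lemma avoids_nbr:
  assumes "b \<in> nbrs 0"
  shows "Pr m (avoids {b}) = Pr (Suc m) (avoids {0})"
proof -
  have nbr: "Pr m (avoids {- e}) = Pr m (avoids {b})" if e: "e \<in> nbrs 0" for e
  proof -
    obtain A where A: "\<And>x y. A (x + y) = A x + A y" "A 0 = 0" "inj A" "A (- e) = b"
      "bij_betw A (nbrs 0) (nbrs 0)"
      using nbrs_0_transitive[OF _ assms, of "- e"] e uminus_nbrs_0 by blast
    have "Pr m (avoids {b}) = Pr m (\<lambda>v. avoids {b} (map A v))"
      by (rule avg_map[OF A(5), symmetric])
    also have "(\<lambda>v. avoids {b} (map A v)) = avoids {- e}"
      using A(3) by (auto simp: avoids_def pos_map[OF A(1,2)] fun_eq_iff inj_eq A(4)[symmetric])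
    finally show ?thesis by simp
  qed
  have "avoids {0} (e # v) \<longleftrightarrow> avoids {- e} v" if e: "e \<in> nbrs 0" for e v
  proof -
    have "avoids {0} (e # v) \<longleftrightarrow> (\<forall>j\<in>Suc ` {0..length v}. pos (e # v) j \<noteq> 0)"
      by (simp add: avoids_def flip: image_Suc_atLeastAtMost)
    also have "\<dots> \<longleftrightarrow> (\<forall>j\<in>{0..length v}. e + pos v j \<noteq> 0)"
      by (simp del: image_Suc_atLeastAtMost)
    \<comment> \<open>The index 0 only asks for e \<noteq> 0, which holds, so the times from 1 on
      remain.\<close>
    also have "\<dots> \<longleftrightarrow> (\<forall>j\<in>insert 0 {1..length v}. e + pos v j \<noteq> 0)"
      by (rule arg_cong[where f = "\<lambda>S. \<forall>j\<in>S. e + pos v j \<noteq> 0"]) auto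
    also have "\<dots> \<longleftrightarrow> avoids {- e} v"
      using e by (auto simp: avoids_def add_eq_0_iff)
    finally show ?thesis .
  qed
  then have "Pr (Suc m) (avoids {0}) = (\<Sum>e\<in>nbrs 0. Pr m (avoids {- e})) / 4"
    unfolding avg_Suc by simp
  also have "\<dots> = Pr m (avoids {b})"
    by (simp add: nbr card_nbrs_0)
  finally show ?thesis by simp
qed

text \<open>First step analysis as in \<open>avoids_nbr\<close>; it transfers the bound on return
  probabilities to the neighbours.\<close>

lemma sum_at_nbr:
  assumes "b \<in> nbrs 0"
  shows "Pr k (\<lambda>v. sum_list v = b) = Pr (Suc k) (\<lambda>v. sum_list v = 0)"
proof -
  have nbr: "Pr k (\<lambda>v. sum_list v = - e) = Pr k (\<lambda>v. sum_list v = b)" if e: "e \<in> nbrs 0" for e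
  proof -
    obtain A where A: "\<And>x y. A (x + y) = A x + A y" "A 0 = 0" "inj A" "A (- e) = b"
      "bij_betw A (nbrs 0) (nbrs 0)"
      using nbrs_0_transitive[OF _ assms, of "- e"] e uminus_nbrs_0 by blast
    have "Pr k (\<lambda>v. sum_list v = b) = Pr k (\<lambda>v. sum_list (map A v) = b)"
      by (rule avg_map[OF A(5), symmetric])
    also have "sum_list (map A v) = A (sum_list v)" for v
      using pos_map[OF A(1,2), of v "length v"] by (simp add: pos_def)
    then have "(\<lambda>v. sum_list (map A v) = b) = (\<lambda>v. sum_list v = - e)"
      using A(3) by (auto simp: fun_eq_iff inj_eq A(4)[symmetric])
    finally show ?thesis by simp
  qed
  have "Pr (Suc k) (\<lambda>v. sum_list v = 0) = (\<Sum>e\<in>nbrs 0. Pr k (\<lambda>v. sum_list v = - e)) / 4"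
    unfolding avg_Suc by (simp add: add_eq_0_iff)
  also have "\<dots> = Pr k (\<lambda>v. sum_list v = b)"
    by (simp add: nbr card_nbrs_0)
  finally show ?thesis by simp
qed

subsection \<open>First passage, last exit and return probabilities\<close>

text \<open>Pointwise form of a last exit decomposition: \<open>P 0\<close> guarantees a last index,
  and its summand is the only one equal to 1.\<close>

lemma last_index_sum:
  fixes P :: "nat \<Rightarrow> bool"
  assumes "P 0"
  shows "(\<Sum>k\<le>m. of_bool (P k \<and> (\<forall>j\<in>{k<..m}. \<not> P j)) :: real) = 1"
proof -
  define K where "K = Max {k. k \<le> m \<and> P k}"
  have "K \<in> {k. k \<le> m \<and> P k}"
    unfolding K_def using assms by (intro Max_in) auto
  then have K: "K \<le> m" "P K" by auto
  have ge: "j \<le> K" if "j \<le> m" "P j" for j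
    unfolding K_def using that by (intro Max_ge) auto
  have "P k \<and> (\<forall>j\<in>{k<..m}. \<not> P j) \<longleftrightarrow> k = K" if "k \<le> m" for k
    using K ge that by (metis greaterThanAtMost_iff le_antisym linorder_not_le)
  then have "(\<Sum>k\<le>m. of_bool (P k \<and> (\<forall>j\<in>{k<..m}. \<not> P j)) :: real) = (\<Sum>k\<le>m. of_bool (k = K))"
    by (intro sum.cong) auto
  also have "\<dots> = 1" using K by (simp add: of_bool_def)
  finally show ?thesis .
qed

text \<open>Pointwise form of a first passage decomposition; the leading term takes the case without
  any passage up to m.\<close>

lemma first_index_sum:
  fixes P :: "nat \<Rightarrow> bool"
  shows "of_bool (\<forall>j\<in>{1..m}. \<not> P j) + (\<Sum>k=1..m. of_bool (P k \<and> (\<forall>j\<in>{1..<k}. \<not> P j)) :: real) = 1"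
proof (cases "\<forall>j\<in>{1..m}. \<not> P j")
  case True
  then show ?thesis by simp
next
  case False
  define K where "K = Min {k\<in>{1..m}. P k}"
  have "K \<in> {k\<in>{1..m}. P k}"
    unfolding K_def using False by (intro Min_in) auto
  then have K: "1 \<le> K" "K \<le> m" "P K" by auto
  have le: "K \<le> j" if "1 \<le> j" "j \<le> m" "P j" for j
    unfolding K_def using that by (intro Min_le) auto
  have "P k \<and> (\<forall>j\<in>{1..<k}. \<not> P j) \<longleftrightarrow> k = K" if "k \<in> {1..m}" for k
  proof -
    have "k \<in> {1..m}" "1 \<le> k" "k \<le> m" using that by auto
    then show ?thesis using K le
      by (metis atLeastLessThan_iff le_antisym linorder_not_le less_le_trans order_less_imp_le)
  qed
  then have "(\<Sum>k=1..m. of_bool (P k \<and> (\<forall>j\<in>{1..<k}. \<not> P j)) :: real) = (\<Sum>k=1..m. of_bool (k = K))"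
    by (intro sum.cong) auto
  also have "\<dots> = 1" using K by (simp add: of_bool_def)
  finally show ?thesis using False by simp
qed

lemma hits_take:
  assumes "1 \<le> k" "k \<le> length v"
  shows "hits D d (take k v) \<longleftrightarrow> pos v k = d \<and> (\<forall>j\<in>{1..<k}. pos v j \<notin> D)"
proof -
  have "take k v \<noteq> []" "length (take k v) = k" using assms by auto
  then show ?thesis unfolding hits_def by auto
qed

lemma avoids_drop:
  assumes "k \<le> length v"
  shows "avoids D (drop k v) \<longleftrightarrow> (\<forall>j\<in>{k<..length v}. pos v j - pos v k \<notin> D)"
proof -
  have "avoids D (drop k v) \<longleftrightarrow> (\<forall>j\<in>{1..length v - k}. pos v (k + j) - pos v k \<notin> D)"
    by (simp add: avoids_def pos_drop)
  also have "\<dots> \<longleftrightarrow> (\<forall>j\<in>{k<..length v}. pos v j - pos v k \<notin> D)"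
  proof (intro iffI ballI)
    fix j assume "\<forall>j\<in>{1..length v - k}. pos v (k + j) - pos v k \<notin> D" "j \<in> {k<..length v}"
    then show "pos v j - pos v k \<notin> D"
      by (auto dest!: bspec[of _ _ "j - k"])
  qed auto
  finally show ?thesis .
qed

lemma avoids_take:
  assumes "k \<le> length v"
  shows "avoids D (take k v) \<longleftrightarrow> (\<forall>j\<in>{1..k}. pos v j \<notin> D)"
  using assms by (auto simp: avoids_def min_def)

lemma avoids_insert: "avoids (insert d D) v \<longleftrightarrow> avoids {d} v \<and> avoids D v"
  by (auto simp: avoids_def)

lemma hits_0 [simp]: "Pr 0 (hits D d) = 0"
  by (simp add: hits_def)

text \<open>Strong Markov property at the first entrance into D, for a general functional so that it
  serves the total mass, the avoidance of 0 and the count of returns. The hypothesis says that once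
  D is entered at d, only the later steps matter.\<close>

lemma first_passage:
  assumes D: "finite D"
    and \<Phi>: "\<And>k d v. v \<in> paths m \<Longrightarrow> 1 \<le> k \<Longrightarrow> k \<le> m \<Longrightarrow> d \<in> D \<Longrightarrow> hits D d (take k v) \<Longrightarrow>
      \<Phi> v = \<Psi> d (drop k v)"
  shows "avg m \<Phi> = avg m (\<lambda>v. \<Phi> v * of_bool (avoids D v)) +
    (\<Sum>d\<in>D. \<Sum>k\<le>m. Pr k (hits D d) * avg (m - k) (\<Psi> d))"
proof -
  have pt: "\<Phi> v = \<Phi> v * of_bool (avoids D v) +
      (\<Sum>k=1..m. \<Sum>d\<in>D. of_bool (hits D d (take k v)) * \<Psi> d (drop k v))" if v: "v \<in> paths m" for v
  proof -
    have len: "length v = m" using v by auto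
    have hd: "(\<Sum>d\<in>D. of_bool (hits D d (take k v)) :: real)
        = of_bool (pos v k \<in> D \<and> (\<forall>j\<in>{1..<k}. pos v j \<notin> D))" if "k \<in> {1..m}" for k
    proof -
      have "(\<Sum>d\<in>D. of_bool (hits D d (take k v)) :: real)
          = (\<Sum>d\<in>D. of_bool (d = pos v k) * of_bool (\<forall>j\<in>{1..<k}. pos v j \<notin> D))"
        using that len by (intro sum.cong) (auto simp: hits_take)
      also have "\<dots> = of_bool (pos v k \<in> D) * of_bool (\<forall>j\<in>{1..<k}. pos v j \<notin> D)"
        using D by (simp add: of_bool_def)
      finally show ?thesis by simp
    qed
    have "\<Phi> v = \<Phi> v * (of_bool (\<forall>j\<in>{1..m}. pos v j \<notin> D) +
        (\<Sum>k=1..m. of_bool (pos v k \<in> D \<and> (\<forall>j\<in>{1..<k}. pos v j \<notin> D))))"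
      using first_index_sum[of m "\<lambda>j. pos v j \<in> D"] by simp
    also have "\<dots> = \<Phi> v * of_bool (avoids D v) + (\<Sum>k=1..m. \<Sum>d\<in>D. of_bool (hits D d (take k v)) * \<Phi> v)"
    proof -
      have "(\<Sum>k=1..m. of_bool (pos v k \<in> D \<and> (\<forall>j\<in>{1..<k}. pos v j \<notin> D)) :: real) =
          (\<Sum>k=1..m. \<Sum>d\<in>D. of_bool (hits D d (take k v)))"
        by (rule sum.cong[OF refl]) (rule hd[symmetric])
      then show ?thesis
        unfolding avoids_def len by (simp only: distrib_left sum_distrib_left mult.commute[of "\<Phi> v"] sum_distrib_right)
    qed
    also have "(\<Sum>k=1..m. \<Sum>d\<in>D. of_bool (hits D d (take k v)) * \<Phi> v) =
        (\<Sum>k=1..m. \<Sum>d\<in>D. of_bool (hits D d (take k v)) * \<Psi> d (drop k v))"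
      using \<Phi>[OF v] by (intro sum.cong refl) auto
    finally show ?thesis .
  qed
  have "avg m \<Phi> = avg m (\<lambda>v. \<Phi> v * of_bool (avoids D v) +
      (\<Sum>k=1..m. \<Sum>d\<in>D. of_bool (hits D d (take k v)) * \<Psi> d (drop k v)))"
    by (rule avg_cong) (rule pt)
  also have "\<dots> = avg m (\<lambda>v. \<Phi> v * of_bool (avoids D v)) +
      (\<Sum>k=1..m. \<Sum>d\<in>D. Pr k (hits D d) * avg (m - k) (\<Psi> d))"
    unfolding avg_add avg_sum by (intro arg_cong2[where f = "(+)"] sum.cong refl avg_split) auto
  \<comment> \<open>A hit at time 0 has probability 0, so the sum may start at 0 and becomes a
    convolution.\<close>
  also have "(\<Sum>k=1..m. \<Sum>d\<in>D. Pr k (hits D d) * avg (m - k) (\<Psi> d)) =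
      (\<Sum>k\<le>m. \<Sum>d\<in>D. Pr k (hits D d) * avg (m - k) (\<Psi> d))"
    by (rule sum.mono_neutral_left) (auto simp: not_less_eq_eq le_Suc_eq simp del: avg_0)
  also have "\<dots> = (\<Sum>d\<in>D. \<Sum>k\<le>m. Pr k (hits D d) * avg (m - k) (\<Psi> d))"
    by (rule sum.swap)
  finally show ?thesis .
qed

text \<open>Cut at the last visit to the origin, which exists because time 0 is one; from there on
  the walk avoids 0 as well. For empty B the left side is 1 and this is the renewal equation of the
  returns.\<close>

lemma last_exit:
  assumes "0 \<notin> B"
  shows "Pr m (avoids B) = (\<Sum>k\<le>m. Pr k (\<lambda>v. avoids B v \<and> sum_list v = 0) * Pr (m - k) (avoids (insert 0 B)))"
proof -
  have "Pr m (avoids B) = avg m (\<lambda>v. \<Sum>k\<le>m. of_bool (avoids B (take k v) \<and> sum_list (take k v) = 0) *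
      of_bool (avoids (insert 0 B) (drop k v)))"
  proof (rule avg_cong)
    fix v assume "v \<in> paths m"
    then have len: "length v = m" by auto
    have "avoids B (take k v) \<and> sum_list (take k v) = 0 \<and> avoids (insert 0 B) (drop k v) \<longleftrightarrow>
        avoids B v \<and> (pos v k = 0 \<and> (\<forall>j\<in>{k<..m}. pos v j \<noteq> 0))" if k: "k \<le> m" for k
    proof -
      have "avoids B v \<longleftrightarrow> (\<forall>j\<in>{1..k} \<union> {k<..m}. pos v j \<notin> B)"
        unfolding avoids_def len using k assms
        by (metis (no_types, opaque_lifting) Un_iff atLeastAtMost_iff greaterThanAtMost_iff
            le_trans linorder_not_le order.strict_implies_order less_one pos_0 not_less)
      moreover have "sum_list (take k v) = pos v k" by (simp add: pos_def)
      ultimately show ?thesis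
        using k len by (auto simp: avoids_take avoids_drop)
    qed
    then have "(\<Sum>k\<le>m. of_bool (avoids B (take k v) \<and> sum_list (take k v) = 0) *
        of_bool (avoids (insert 0 B) (drop k v)) :: real) =
        (\<Sum>k\<le>m. of_bool (avoids B v) * of_bool (pos v k = 0 \<and> (\<forall>j\<in>{k<..m}. pos v j \<noteq> 0)))"
      by (intro sum.cong refl) (simp only: of_bool_conj[symmetric] atMost_iff conj_assoc)
    also have "\<dots> = of_bool (avoids B v)"
      unfolding sum_distrib_left[symmetric] by (subst last_index_sum) auto
    finally show "of_bool (avoids B v) = (\<Sum>k\<le>m. of_bool (avoids B (take k v) \<and> sum_list (take k v) = 0) *
        of_bool (avoids (insert 0 B) (drop k v)) :: real)" by simp
  qed
  also have "\<dots> = (\<Sum>k\<le>m. Pr k (\<lambda>v. avoids B v \<and> sum_list v = 0) * Pr (m - k) (avoids (insert 0 B)))"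
    unfolding avg_sum by (intro sum.cong refl avg_split) auto
  finally show ?thesis .
qed

lemma Pr_prefix_mono:
  assumes "i \<le> n" "\<And>v. v \<in> paths n \<Longrightarrow> P v \<Longrightarrow> Q (take i v)"
  shows "Pr n P \<le> Pr i Q"
proof -
  have "Pr n P \<le> avg n (\<lambda>v. of_bool (Q (take i v)) * 1)"
    using assms(2) by (intro avg_mono) auto
  also have "\<dots> = Pr i Q" using avg_split[OF assms(1), of "\<lambda>v. of_bool (Q v)" "\<lambda>_. 1"] by simp
  finally show ?thesis .
qed

lemma avoids_antimono: "m \<le> n \<Longrightarrow> Pr n (avoids D) \<le> Pr m (avoids D)"
  by (rule Pr_prefix_mono) (auto simp: avoids_def)

section \<open>Return probabilities and the constant pi\<close>

fun pm_walks :: "nat \<Rightarrow> int \<Rightarrow> nat" where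
  "pm_walks 0 u = of_bool (u = 0)"
| "pm_walks (Suc n) u = pm_walks n (u - 1) + pm_walks n (u + 1)"

text \<open>In the coordinates \<open>x + y\<close> and \<open>x - y\<close> the walk is a pair of independent \<open>\<plusminus>1\<close> walks.\<close>

lemma Pr_position:
  "Pr n (\<lambda>v. sum_list v = (x, y)) = real (pm_walks n (x + y) * pm_walks n (x - y)) / 4 ^ n"
proof (induction n arbitrary: x y)
  case 0
  show ?case by (auto simp: zero_prod_def)
next
  case (Suc n)
  have "e + s = (x, y) \<longleftrightarrow> s = (x - fst e, y - snd e)" for e s :: "int \<times> int"
    by (cases e; cases s) auto
  then have "Pr (Suc n) (\<lambda>v. sum_list v = (x, y)) =
      (\<Sum>e\<in>nbrs 0. Pr n (\<lambda>v. sum_list v = (x - fst e, y - snd e))) / 4"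
    by (simp add: avg_Suc)
  also have "\<dots> = real (pm_walks (Suc n) (x + y) * pm_walks (Suc n) (x - y)) / 4 ^ Suc n"
    unfolding Suc.IH unfolding nbrs_0 by (simp add: algebra_simps add_divide_distrib)
  finally show ?case .
qed

lemma pm_walks_outside: "\<bar>u\<bar> > int n \<Longrightarrow> pm_walks n u = 0"
  by (induction n arbitrary: u) auto

lemma pm_walks_odd: "odd (int n + u) \<Longrightarrow> pm_walks n u = 0"
  by (induction n arbitrary: u) auto

lemma pm_walks_binomial: "pm_walks n (2 * int j - int n) = n choose j"
proof (induction n arbitrary: j)
  case 0
  show ?case by (cases j) auto
next
  case (Suc n)
  show ?case
  proof (cases j)
    case 0
    have "2 * int 0 - int n = - int n" by simp
    then show ?thesis
      using Suc.IH[of 0] 0 by (simp add: pm_walks_outside)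
  next
    case (Suc i)
    have "2 * int j - int (Suc n) - 1 = 2 * int i - int n"
      "2 * int j - int (Suc n) + 1 = 2 * int j - int n" using Suc by simp_all
    then show ?thesis by (simp only: pm_walks.simps Suc.IH) (simp add: Suc)
  qed
qed

lemma return_prob_odd: "odd k \<Longrightarrow> Pr k (\<lambda>v. sum_list v = 0) = 0"
  using Pr_position[of k 0 0] by (simp add: zero_prod_def pm_walks_odd)

lemma return_prob_even: "Pr (2 * k) (\<lambda>v. sum_list v = 0) = (real (2 * k choose k) / 4 ^ k)\<^sup>2"
  using Pr_position[of "2 * k" 0 0] pm_walks_binomial[of "2 * k" k]
  by (simp add: zero_prod_def power2_eq_square power_mult flip: power_mult_distrib)

text \<open>((2n choose n) / 4^n)^2 (2n + 1) is the reciprocal of the n-th partial Wallis product,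
  as the ratios of consecutive terms show.\<close>

lemma return_prob_wallis:
  "Pr (2 * n) (\<lambda>v. sum_list v = 0) * (2 * real n + 1) = inverse (\<Prod>k=1..n. (4 * real k ^ 2) / (4 * real k ^ 2 - 1))"
proof (induction n)
  case 0
  show ?case by simp
next
  case (Suc n)
  have c: "real (2 * Suc n choose Suc n) = real (2 * n choose n) * (2 * (2 * real n + 1) / (real n + 1))"
  proof -
    have "real (2 * m choose m) = fact (2 * m) / (fact m * fact m)" for m
      by (simp add: binomial_fact)
    moreover have "fact (2 * Suc n) = (2 * real n + 2) * (2 * real n + 1) * fact (2 * n)"
      by (simp add: algebra_simps)
    moreover have "fact (Suc n) = (real n + 1) * fact n" by simp
    moreover have "((2 * x) * y * F) / ((x * G) * (x * G)) = F / (G * G) * (2 * y / x)"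
      if "x \<noteq> 0" for x y F G :: real
      using that by (simp add: mult_ac)
    from this[of "real n + 1"] have "((2 * real n + 2) * y * F) / (((real n + 1) * G) * ((real n + 1) * G))
        = F / (G * G) * (2 * y / (real n + 1))" for y F G by simp
    ultimately show ?thesis by (simp only:)
  qed
  have pos: "4 * (1 + real n)\<^sup>2 - 1 = (2 * real n + 1) * (2 * real n + 3)"
    by (simp add: power2_eq_square algebra_simps)
  have "Pr (2 * Suc n) (\<lambda>v. sum_list v = 0) * (2 * real (Suc n) + 1) =
      (Pr (2 * n) (\<lambda>v. sum_list v = 0) * (2 * real n + 1)) * ((2 * real n + 1) * (2 * real n + 3) / (4 * (1 + real n)\<^sup>2))"
    unfolding return_prob_even c by (simp add: divide_simps power_mult_distrib power2_eq_square) (simp add: algebra_simps)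
  also have "\<dots> = inverse (\<Prod>k=1..n. (4 * real k ^ 2) / (4 * real k ^ 2 - 1)) * inverse ((4 * (1 + real n)\<^sup>2) / (4 * (1 + real n)\<^sup>2 - 1))"
    unfolding Suc.IH pos by simp
  also have "\<dots> = inverse (\<Prod>k=1..Suc n. (4 * real k ^ 2) / (4 * real k ^ 2 - 1))"
    by (subst prod.nat_ivl_Suc') (simp_all only: of_nat_Suc inverse_mult_distrib mult.commute)
  finally show ?case .
qed

lemma return_prob_limit: "(\<lambda>k. Pr (2 * k) (\<lambda>v. sum_list v = 0) * real k) \<longlonglongrightarrow> 1 / pi"
proof -
  \<comment> \<open>The reciprocal Wallis product tends to 2 / pi, and k / (2 k + 1) to 1 /
    2.\<close>
  have "(\<lambda>k. (Pr (2 * k) (\<lambda>v. sum_list v = 0) * (2 * real k + 1)) * (real k / (2 * real k + 1))) \<longlonglongrightarrow> inverse (pi / 2) * (1 / 2)"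
    unfolding return_prob_wallis by (intro tendsto_mult tendsto_inverse wallis) (simp, real_asymp)
  moreover have "2 * real k + 1 \<noteq> 0" for k by (metis of_nat_0_le_iff add_nonneg_pos less_irrefl mult_nonneg_nonneg zero_le_numeral zero_less_one)
  ultimately show ?thesis by simp
qed

lemma return_prob_bound:
  obtains C where "\<And>k. k \<ge> 1 \<Longrightarrow> Pr k (\<lambda>v. sum_list v = 0) \<le> C / real k"
proof -
  have "Bseq (\<lambda>k. Pr (2 * k) (\<lambda>v. sum_list v = 0) * real k)"
    using return_prob_limit convergentI convergent_imp_Bseq by blast
  then obtain K where K: "K > 0" "\<And>k. \<bar>Pr (2 * k) (\<lambda>v. sum_list v = 0) * real k\<bar> \<le> K"
    by (auto simp: Bseq_def)
  show ?thesis
  proof (rule that[of "2 * K"])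
    fix k :: nat assume k: "k \<ge> 1"
    show "Pr k (\<lambda>v. sum_list v = 0) \<le> 2 * K / real k"
    proof (cases "even k")
      case True
      then obtain j where "k = 2 * j" by blast
      then show ?thesis using K(2)[of j] k by (simp add: field_simps)
    next
      case False
      then show ?thesis using K(1) by (simp add: return_prob_odd)
    qed
  qed
qed

text \<open>Only even times contribute: the terms are about 1 / (pi j) for j up to n div 2, and
  halving n does not change the leading order of the logarithm.\<close>

lemma green_function_limit:
  "(\<lambda>n. (\<Sum>k\<le>n. Pr k (\<lambda>v. sum_list v = 0)) / ln (real n)) \<longlonglongrightarrow> 1 / pi"
proof -
  define p where "p k = Pr k (\<lambda>v. sum_list v = 0)" for k
  have p0: "p 0 = 1" by (simp add: p_def)
  have even: "(\<Sum>k\<le>n. p k) = 1 + (\<Sum>j=1..n div 2. p (2 * j))" for n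
  proof -
    have "(\<Sum>k\<le>n. p k) = (\<Sum>k\<in>(*) 2 ` {..n div 2}. p k)"
    proof (rule sum.mono_neutral_right)
      show "\<forall>i\<in>{..n} - (*) 2 ` {..n div 2}. p i = 0"
      proof
        fix i assume i: "i \<in> {..n} - (*) 2 ` {..n div 2}"
        have "odd i"
        proof
          assume "even i"
          then have "i = 2 * (i div 2)" "i div 2 \<le> n div 2" using i by (auto simp: div_le_mono)
          then show False using i by blast
        qed
        then show "p i = 0" by (simp add: p_def return_prob_odd)
      qed
    qed auto
    also have "\<dots> = (\<Sum>j\<le>n div 2. p (2 * j))"
      by (subst sum.reindex) (auto simp: inj_on_def)
    also have "\<dots> = 1 + (\<Sum>j=1..n div 2. p (2 * j))"
      by (simp add: atMost_atLeast0 sum.atLeast_Suc_atMost p0)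
    finally show ?thesis .
  qed
  have "(\<lambda>n. (\<Sum>j=1..n. p (2 * j)) / ln (real n)) \<longlonglongrightarrow> 1 / pi"
    unfolding p_def by (rule sum_harmonic_asymp) (rule return_prob_limit)
  moreover have "filterlim (\<lambda>n::nat. n div 2) at_top at_top"
    by (rule filterlim_at_top_div_const_nat) simp
  ultimately have 1: "(\<lambda>n. (\<Sum>j=1..n div 2. p (2 * j)) / ln (real (n div 2))) \<longlonglongrightarrow> 1 / pi"
    by (rule filterlim_compose)
  have 2: "(\<lambda>n. ln (real (n div 2)) / ln (real n)) \<longlonglongrightarrow> 1"
    by real_asymp
  have "(\<lambda>n. 1 / ln (real n) + (\<Sum>j=1..n div 2. p (2 * j)) / ln (real (n div 2)) * (ln (real (n div 2)) / ln (real n)))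
      \<longlonglongrightarrow> 0 + 1 / pi * 1"
    by (intro tendsto_add tendsto_mult 1 2) real_asymp
  moreover have "eventually (\<lambda>n. 1 / ln (real n) + (\<Sum>j=1..n div 2. p (2 * j)) / ln (real (n div 2)) * (ln (real (n div 2)) / ln (real n))
      = (\<Sum>k\<le>n. p k) / ln (real n)) sequentially"
    using eventually_gt_at_top[of 4]
  proof eventually_elim
    case (elim n)
    then have "ln (real (n div 2)) \<noteq> 0" by (simp add: ln_eq_zero_iff)
    then show ?case by (simp add: even add_divide_distrib)
  qed
  ultimately show ?thesis unfolding p_def by (simp add: tendsto_cong)
qed

text \<open>The returns to 0 form a renewal process: \<open>last_exit\<close> for B = {} is its
  renewal equation, and the Green function gives l = 1 / pi.\<close>

lemma no_return_limit: "(\<lambda>n. Pr n (avoids {0}) * ln (real n)) \<longlonglongrightarrow> pi"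
proof -
  obtain C where C: "\<And>k. k \<ge> 1 \<Longrightarrow> Pr k (\<lambda>v. sum_list v = 0) \<le> C / real k"
    using return_prob_bound by blast
  have "(\<lambda>n. Pr n (avoids {0}) * ln (real n)) \<longlonglongrightarrow> 1 / (1 / pi)"
  proof (rule renewal_tail_log_limit[OF _ _ C _ _ avoids_antimono _ green_function_limit])
    fix n
    have "avoids {} v" for v by (simp add: avoids_def)
    then show "(\<Sum>k\<le>n. Pr k (\<lambda>v. sum_list v = 0) * Pr (n - k) (avoids {0})) = 1"
      using last_exit[of "{}" n] by simp
  qed (auto simp: Pr_nonneg Pr_le_1)
  then show ?thesis by simp
qed

subsection \<open>Avoiding a set of neighbours\<close>

text \<open>The start at time 0 is not among the returns, so q stands for at least
  \<open>Suc q\<close> visits to the starting point.\<close>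

definition returned :: "(int \<times> int) set \<Rightarrow> nat \<Rightarrow> (int \<times> int) list \<Rightarrow> bool" where
  "returned B q v \<longleftrightarrow> avoids B v \<and> q \<le> returns v"

lemma returned_0 [simp]: "returned B 0 = avoids B"
  by (simp add: returned_def fun_eq_iff)

lemma avoids_after_hit:
  assumes "k \<le> length v" "1 \<le> k" "hits D d (take k v)" "B \<subseteq> D"
  shows "avoids B v \<longleftrightarrow> d \<notin> B \<and> avoids ((\<lambda>x. x - d) ` B) (drop k v)"
proof -
  have k: "pos v k = d" "\<forall>j\<in>{1..<k}. pos v j \<notin> D"
    using assms by (simp_all add: hits_take)
  have "{1..length v} = {1..<k} \<union> {k} \<union> {k<..length v}" using assms by auto
  then have "avoids B v \<longleftrightarrow> d \<notin> B \<and> (\<forall>j\<in>{k<..length v}. pos v j \<notin> B)"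
    using k assms(4) by (auto simp: avoids_def)
  also have "(\<forall>j\<in>{k<..length v}. pos v j \<notin> B) \<longleftrightarrow> avoids ((\<lambda>x. x - d) ` B) (drop k v)"
    using k assms(1) by (auto simp: avoids_drop image_iff)
  finally show ?thesis .
qed

lemma returns_after_hit:
  assumes "k \<le> length v" "1 \<le> k" "hits (insert 0 B) 0 (take k v)"
  shows "returns v = Suc (returns (drop k v))"
proof -
  have k: "pos v k = 0" "\<forall>j\<in>{1..<k}. pos v j \<notin> insert 0 B"
    using assms by (simp_all add: hits_take)
  have "{j\<in>{1..length v}. pos v j = 0} = insert k ((+) k ` {j\<in>{1..length (drop k v)}. pos (drop k v) j = 0})"
    (is "?l = ?r")
  proof
    show "?l \<subseteq> ?r"
    proof
      fix j assume j: "j \<in> ?l"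
      then have "k \<le> j" using k(2) by (metis (mono_tags, lifting) atLeastAtMost_iff atLeastLessThan_iff insertI1 linorder_not_le mem_Collect_eq)
      then show "j \<in> ?r" using j k
        by (cases "j = k") (auto simp: pos_drop image_iff intro!: exI[of _ "j - k"])
    qed
    show "?r \<subseteq> ?l" using k assms by (auto simp: pos_drop)
  qed
  then have "returns v = card (insert k ((+) k ` {j\<in>{1..length (drop k v)}. pos (drop k v) j = 0}))"
    by (simp add: returns_def)
  also have "\<dots> = Suc (returns (drop k v))"
    by (subst card_insert_disjoint) (auto simp: returns_def card_image)
  finally show ?thesis .
qed

lemma returns_0_iff: "returns v = 0 \<longleftrightarrow> avoids {0} v"
  by (auto simp: returns_def avoids_def)

lemma hits_imp_sum: "hits D d v \<Longrightarrow> sum_list v = d"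
  by (simp add: hits_def pos_def)

text \<open>First passages at different times are disjoint events, so their probabilities add up to
  at most 1.\<close>

lemma summable_hits:
  assumes "finite D" "d \<in> D"
  shows "summable (\<lambda>k. Pr k (hits D d))"
proof (rule summableI_nonneg_bounded)
  fix n
  have "(\<Sum>k<n. Pr k (hits D d)) \<le> (\<Sum>k\<le>n. Pr k (hits D d) * 1)"
    by (auto intro!: sum_mono2 Pr_nonneg)
  also have "\<dots> \<le> (\<Sum>e\<in>D. \<Sum>k\<le>n. Pr k (hits D e) * 1)"
    using assms by (intro member_le_sum sum_nonneg mult_nonneg_nonneg Pr_nonneg) auto
  also have "\<dots> \<le> 1"
    using first_passage[OF assms(1), of n "\<lambda>_. 1" "\<lambda>_ _. 1"] Pr_nonneg[of n "avoids D"] by simp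
  finally show "(\<Sum>k<n. Pr k (hits D d)) \<le> 1" .
qed (rule Pr_nonneg)

text \<open>Supplies the bound C / k that \<open>convolution_log_limit\<close> asks for, since a
  first hit at d is in particular a visit to d.\<close>

lemma position_prob_bound:
  assumes "d \<in> insert 0 (nbrs 0)"
  obtains C where "\<And>k. k \<ge> 1 \<Longrightarrow> Pr k (\<lambda>v. sum_list v = d) \<le> C / real k"
proof -
  obtain C where C: "\<And>k. k \<ge> 1 \<Longrightarrow> Pr k (\<lambda>v. sum_list v = 0) \<le> C / real k"
    using return_prob_bound by blast
  have C0: "C \<ge> 0" using C[of 1] Pr_nonneg[of 1 "\<lambda>v. sum_list v = 0"] by simp
  show ?thesis
  proof (rule that[of C])
    fix k :: nat assume k: "k \<ge> 1"
    show "Pr k (\<lambda>v. sum_list v = d) \<le> C / real k"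
    proof (cases "d = 0")
      case False
      then have "Pr k (\<lambda>v. sum_list v = d) = Pr (Suc k) (\<lambda>v. sum_list v = 0)"
        using assms by (intro sum_at_nbr) auto
      also have "\<dots> \<le> C / real (Suc k)" by (rule C) simp
      also have "\<dots> \<le> C / real k" using C0 k by (intro divide_left_mono) auto
      finally show ?thesis .
    qed (use C k in simp)
  qed
qed

lemma no_return_Suc_limit: "(\<lambda>m. Pr (Suc m) (avoids {0}) * ln (real m)) \<longlonglongrightarrow> pi"
proof -
  have "(\<lambda>m. (Pr (Suc m) (avoids {0}) * ln (real (Suc m))) * (ln (real m) / ln (real (Suc m)))) \<longlonglongrightarrow> pi * 1"
    by (intro tendsto_mult filterlim_compose[OF no_return_limit filterlim_Suc]) real_asymp
  moreover have "eventually (\<lambda>m. (Pr (Suc m) (avoids {0}) * ln (real (Suc m))) * (ln (real m) / ln (real (Suc m)))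
      = Pr (Suc m) (avoids {0}) * ln (real m)) sequentially"
    using eventually_gt_at_top[of 0] by eventually_elim simp
  ultimately show ?thesis by (simp add: tendsto_cong)
qed

locale boundary_set =
  fixes B :: "(int \<times> int) set"
  assumes B: "B \<subseteq> nbrs 0" "B \<noteq> {}"
begin

lemma finite_B: "finite B" and zero_notin_B: "0 \<notin> B"
  using B finite_subset[OF B(1)] by auto

text \<open>P(T_0 < T_B), with T_B the first time after 0 in B; for B = {b} it is the constant of
  the theorem, by \<open>prob_return_before\<close>.\<close>

definition first_return :: real where
  "first_return = (\<Sum>k. Pr k (hits (insert 0 B) 0))"

definition first_hit :: "int \<times> int \<Rightarrow> real" where
  "first_hit b = (\<Sum>k. Pr k (hits (insert 0 B) b))"

text \<open>Of the coefficient pi for avoiding 0, the part pi * \<open>first_hit b\<close> belongs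
  to walks that enter B first at b. By \<open>total_hit\<close> the rest equals
  \<open>pi * first_return\<close>.\<close>

definition escape :: real where
  "escape = pi * (1 - (\<Sum>b\<in>B. first_hit b))"

lemma convolution_hits:
  assumes "d \<in> insert 0 B" "(\<lambda>m. g m * ln (real m)) \<longlonglongrightarrow> \<gamma>"
  shows "(\<lambda>m. (\<Sum>k\<le>m. Pr k (hits (insert 0 B) d) * g (m - k)) * ln (real m))
    \<longlonglongrightarrow> (\<Sum>k. Pr k (hits (insert 0 B) d)) * \<gamma>"
proof -
  obtain C where C: "\<And>k. k \<ge> 1 \<Longrightarrow> Pr k (\<lambda>v. sum_list v = d) \<le> C / real k"
    using position_prob_bound[of d] assms(1) B(1) by blast
  show ?thesis
  proof (rule convolution_log_limit[OF Pr_nonneg _ summable_hits assms(2)])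
    fix k :: nat assume "k \<ge> 1"
    then show "Pr k (hits (insert 0 B) d) \<le> C / real k"
      by (intro order_trans[OF Pr_mono C]) (auto dest: hits_imp_sum)
  qed (use assms finite_B in auto)
qed

text \<open>Walks avoiding 0 are split at their first entrance into B. After an entrance at b the
  walk must avoid -b as seen from there, again a neighbour, so \<open>avoids_nbr\<close> gives the
  tail of T_0 one step later, with the same asymptotics.\<close>

lemma avoid_limit: "(\<lambda>m. Pr m (avoids (insert 0 B)) * ln (real m)) \<longlonglongrightarrow> escape"
proof -
  let ?D = "insert 0 B"
  have eq: "Pr m (avoids ?D) = Pr m (avoids {0}) - (\<Sum>b\<in>B. \<Sum>k\<le>m. Pr k (hits ?D b) * Pr (Suc (m - k)) (avoids {0}))" for m
  proof -
    have "Pr m (avoids {0}) = avg m (\<lambda>v. of_bool (avoids {0} v) * of_bool (avoids ?D v)) +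
        (\<Sum>d\<in>?D. \<Sum>k\<le>m. Pr k (hits ?D d) * Pr (m - k) (\<lambda>w. d \<noteq> 0 \<and> avoids {- d} w))"
    proof (rule first_passage)
      fix k d v assume v: "v \<in> paths m" "1 \<le> k" "k \<le> m" "d \<in> ?D" "hits ?D d (take k v)"
      then show "of_bool (avoids {0} v) = of_bool (d \<noteq> 0 \<and> avoids {- d} (drop k v))"
        using avoids_after_hit[of k v ?D d "{0}"] by auto
    qed (use finite_B in auto)
    also have "avg m (\<lambda>v. of_bool (avoids {0} v) * of_bool (avoids ?D v)) = Pr m (avoids ?D)"
      by (intro avg_cong) (simp add: avoids_insert[of 0 B])
    also have "(\<Sum>d\<in>?D. \<Sum>k\<le>m. Pr k (hits ?D d) * Pr (m - k) (\<lambda>w. d \<noteq> 0 \<and> avoids {- d} w)) =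
        (\<Sum>b\<in>B. \<Sum>k\<le>m. Pr k (hits ?D b) * Pr (Suc (m - k)) (avoids {0}))"
    proof -
      have "Pr j (\<lambda>w. b \<noteq> 0 \<and> avoids {- b} w) = Pr (Suc j) (avoids {0})" if "b \<in> B" for b j
      proof -
        have b: "b \<in> nbrs 0" using that B by blast
        then have "b \<noteq> 0" using zero_notin_nbrs_0 by blast
        then have "Pr j (\<lambda>w. b \<noteq> 0 \<and> avoids {- b} w) = Pr j (avoids {- b})" by simp
        then show ?thesis using avoids_nbr[of "- b" j] b by simp
      qed
      then show ?thesis using finite_B zero_notin_B by simp
    qed
    finally show ?thesis by simp
  qed
  have "(\<lambda>m. Pr m (avoids {0}) * ln (real m) - (\<Sum>b\<in>B. (\<Sum>k\<le>m. Pr k (hits ?D b) * Pr (Suc (m - k)) (avoids {0})) * ln (real m)))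
      \<longlonglongrightarrow> pi - (\<Sum>b\<in>B. first_hit b * pi)"
    unfolding first_hit_def
    by (intro tendsto_diff tendsto_sum no_return_limit convolution_hits no_return_Suc_limit) auto
  then show ?thesis
    unfolding eq escape_def by (simp add: left_diff_distrib sum_distrib_right sum_distrib_left mult_ac right_diff_distrib)
qed

text \<open>Recurrence: by \<open>avoid_limit\<close> the probability of avoiding 0 and B up to time
  m tends to 0, so the first passage probabilities exhaust the mass 1.\<close>

lemma total_hit: "first_return + (\<Sum>b\<in>B. first_hit b) = 1"
proof -
  let ?D = "insert 0 B"
  have eq: "(\<Sum>d\<in>?D. \<Sum>k\<le>m. Pr k (hits ?D d)) = 1 - Pr m (avoids ?D)" for m
    using first_passage[of ?D m "\<lambda>_. 1" "\<lambda>_ _. 1"] finite_B by simp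
  have "(\<lambda>m. (Pr m (avoids ?D) * ln (real m)) * (1 / ln (real m))) \<longlonglongrightarrow> escape * 0"
    by (intro tendsto_mult avoid_limit) real_asymp
  moreover have "eventually (\<lambda>m. (Pr m (avoids ?D) * ln (real m)) * (1 / ln (real m)) = Pr m (avoids ?D)) sequentially"
    using eventually_gt_at_top[of 1] by eventually_elim simp
  ultimately have "(\<lambda>m. Pr m (avoids ?D)) \<longlonglongrightarrow> 0"
    by (simp add: tendsto_cong)
  then have "(\<lambda>m. \<Sum>d\<in>?D. \<Sum>k\<le>m. Pr k (hits ?D d)) \<longlonglongrightarrow> 1 - 0"
    unfolding eq by (intro tendsto_intros)
  moreover have "(\<lambda>m. \<Sum>d\<in>?D. \<Sum>k\<le>m. Pr k (hits ?D d)) \<longlonglongrightarrow> (\<Sum>d\<in>?D. \<Sum>k. Pr k (hits ?D d))"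
    by (intro tendsto_sum summable_LIMSEQ' summable_hits) (use finite_B in auto)
  ultimately have "(\<Sum>d\<in>?D. \<Sum>k. Pr k (hits ?D d)) = 1"
    using LIMSEQ_unique by fastforce
  then show ?thesis
    using finite_B zero_notin_B by (simp add: first_return_def first_hit_def)
qed

text \<open>After each visit to the origin the walk steps into \<open>B\<close> with probability at least
  \<open>1/4\<close>, so it makes at most four visits on average before entering \<open>B\<close>.\<close>

lemma summable_green: "summable (\<lambda>k. Pr k (\<lambda>v. avoids B v \<and> sum_list v = 0))"
proof (rule summableI_nonneg_bounded)
  fix n
  obtain b where b: "b \<in> B" using B by blast
  have bn: "b \<in> nbrs 0" using b B by blast
  let ?E = "\<lambda>k v. avoids B (take k v) \<and> sum_list (take k v) = 0 \<and> take 1 (drop k v) = [b]"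
  have "Pr k (\<lambda>v. avoids B v \<and> sum_list v = 0) * (1 / 4) = Pr n (?E k)" if k: "k < n" for k
  proof -
    have "Pr 1 (\<lambda>v. v = [b]) = 1 / 4"
      using bn by (simp add: avg_1 of_bool_def)
    moreover have "Pr (n - k) (\<lambda>w. take 1 w = [b]) = Pr 1 (\<lambda>v. v = [b])"
      using avg_split[of 1 "n - k" "\<lambda>v. of_bool (v = [b])" "\<lambda>_. 1"] k by simp
    ultimately show ?thesis
      using avg_split[of k n "\<lambda>v. of_bool (avoids B v \<and> sum_list v = 0)" "\<lambda>w. of_bool (take 1 w = [b])"] k
      by (simp add: conj_assoc flip: of_bool_conj)
  qed
  then have "(\<Sum>k<n. Pr k (\<lambda>v. avoids B v \<and> sum_list v = 0)) * (1 / 4) = (\<Sum>k<n. Pr n (?E k))"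
    by (simp add: sum_distrib_right)
  also have "\<dots> = avg n (\<lambda>v. \<Sum>k<n. of_bool (?E k v))"
    by (simp only: avg_sum)
  also have "\<dots> \<le> avg n (\<lambda>_. 1)"
  proof (rule avg_mono)
    fix v assume "v \<in> paths n"
    then have len: "length v = n" by auto
    have hit: "pos v k = 0" "pos v (Suc k) = b" "\<forall>j\<in>{1..k}. pos v j \<notin> B" if "?E k v" "k < n" for k
    proof -
      have "take 1 (drop k v) = [b]" using that by blast
      with take_add[of k 1 v] have "take (k + 1) v = take k v @ [b]" by (simp only:)
      then show "pos v (Suc k) = b" "pos v k = 0" using that by (simp_all add: pos_def)
      show "\<forall>j\<in>{1..k}. pos v j \<notin> B" using that len by (simp add: avoids_take)
    qed
    \<comment> \<open>\<open>?E k v\<close> puts the walk at b at time \<open>Suc k\<close>, which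
      is at most l, and \<open>?E l v\<close> forbids visits to B up to time l. Hence the events are
      disjoint.\<close>
    have uniq: "\<not> (?E k v \<and> ?E l v)" if "k < l" "l < n" for k l
      using hit(2)[of k] hit(3)[of l] that b by fastforce
    have "k = l" if "k \<in> {k. k < n \<and> ?E k v}" "l \<in> {k. k < n \<and> ?E k v}" for k l
      using uniq[of k l] uniq[of l k] that by (cases k l rule: linorder_cases) blast+
    then have "card {k. k < n \<and> ?E k v} \<le> Suc 0"
      by (subst card_le_Suc0_iff_eq) simp_all
    then show "(\<Sum>k<n. of_bool (?E k v)) \<le> (1 :: real)"
      by (simp add: lessThan_def Int_def conj_commute)
  qed
  finally show "(\<Sum>k<n. Pr k (\<lambda>v. avoids B v \<and> sum_list v = 0)) \<le> 4" by simp
qed (rule Pr_nonneg)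

text \<open>The series is the Green function at 0 of the walk killed on B: the expected number of
  visits to 0 before B, the start included.\<close>

definition survive :: real where
  "survive = (\<Sum>k. Pr k (\<lambda>v. avoids B v \<and> sum_list v = 0)) * escape"

lemma survive_limit: "(\<lambda>m. Pr m (avoids B) * ln (real m)) \<longlonglongrightarrow> survive"
proof -
  obtain C where C: "\<And>k. k \<ge> 1 \<Longrightarrow> Pr k (\<lambda>v. sum_list v = 0) \<le> C / real k"
    using return_prob_bound by blast
  show ?thesis
    unfolding last_exit[OF zero_notin_B] survive_def
  proof (rule convolution_log_limit[OF Pr_nonneg _ summable_green avoid_limit])
    fix k :: nat assume "k \<ge> 1"
    then show "Pr k (\<lambda>v. avoids B v \<and> sum_list v = 0) \<le> C / real k"
      by (intro order_trans[OF Pr_mono C]) auto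
  qed
qed

text \<open>An entrance into B before the first return contributes nothing, and the first return
  leaves q returns to be made after it.\<close>

lemma returned_Suc:
  "Pr m (returned B (Suc q)) = (\<Sum>k\<le>m. Pr k (hits (insert 0 B) 0) * Pr (m - k) (returned B q))"
proof -
  let ?D = "insert 0 B"
  have "Pr m (returned B (Suc q)) = avg m (\<lambda>v. of_bool (returned B (Suc q) v) * of_bool (avoids ?D v)) +
      (\<Sum>d\<in>?D. \<Sum>k\<le>m. Pr k (hits ?D d) * Pr (m - k) (\<lambda>w. d = 0 \<and> returned B q w))"
  proof (rule first_passage)
    fix k d v assume v: "v \<in> paths m" "1 \<le> k" "k \<le> m" "d \<in> ?D" "hits ?D d (take k v)"
    then have len: "k \<le> length v" by auto
    have av: "avoids B v \<longleftrightarrow> d = 0 \<and> avoids ((\<lambda>x. x - d) ` B) (drop k v)"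
      using avoids_after_hit[OF len v(2,5), of B] v(4) zero_notin_B by auto
    show "of_bool (returned B (Suc q) v) = of_bool (d = 0 \<and> returned B q (drop k v))"
    proof (cases "d = 0")
      case True
      then show ?thesis
        using av returns_after_hit[OF len v(2)] v(5) by (simp add: returned_def)
    next
      case False
      then show ?thesis using av by (simp add: returned_def)
    qed
  qed (use finite_B in auto)
  \<comment> \<open>A path avoiding 0 has no return at all, hence never \<open>Suc q\<close> of
    them.\<close>
  also have "avg m (\<lambda>v. of_bool (returned B (Suc q) v) * of_bool (avoids ?D v)) = avg m (\<lambda>_. 0)"
    by (intro avg_cong) (auto simp: returned_def avoids_insert[of 0 B] simp flip: returns_0_iff)
  also have "(\<Sum>d\<in>?D. \<Sum>k\<le>m. Pr k (hits ?D d) * Pr (m - k) (\<lambda>w. d = 0 \<and> returned B q w)) =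
      (\<Sum>k\<le>m. Pr k (hits ?D 0) * Pr (m - k) (returned B q))"
  proof -
    have "(\<Sum>d\<in>B. \<Sum>k\<le>m. Pr k (hits ?D d) * Pr (m - k) (\<lambda>w. d = 0 \<and> returned B q w)) = 0"
    proof (intro sum.neutral ballI)
      fix d k assume "d \<in> B"
      then have "d \<noteq> 0" using zero_notin_B by auto
      then show "Pr k (hits ?D d) * Pr (m - k) (\<lambda>w. d = 0 \<and> returned B q w) = 0" by simp
    qed
    then show ?thesis using finite_B zero_notin_B by simp
  qed
  finally show ?thesis by simp
qed

text \<open>Each return costs one convolution with the law of the first return, hence a factor
  \<open>first_return\<close>. For a single neighbour this is the power of c in the theorem.\<close>

lemma returned_limit: "(\<lambda>m. Pr m (returned B q) * ln (real m)) \<longlonglongrightarrow> first_return ^ q * survive"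
proof (induction q)
  case 0
  show ?case using survive_limit by simp
next
  case (Suc q)
  show ?case
    unfolding returned_Suc power_Suc mult.assoc using convolution_hits[OF _ Suc] by (simp add: first_return_def)
qed

end

text \<open>Splitting \<open>P(T\<^sub>b > m) \<sim> \<pi> / ln m\<close> according to whether the walk returns to the
  origin gives \<open>\<pi> = \<pi> F + F \<pi>\<close> with \<open>F = P(T\<^sub>0 < T\<^sub>b)\<close>.\<close>

lemma single_nbr_constants:
  assumes "b \<in> nbrs 0"
  shows "boundary_set.first_return {b} = 1 / 2" "boundary_set.escape {b} = pi / 2"
    "boundary_set.survive {b} = pi"
proof -
  interpret boundary_set "{b}" using assms by unfold_locales auto
  have "(\<lambda>m. Pr m (avoids {b}) * ln (real m)) \<longlonglongrightarrow> pi"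
    unfolding avoids_nbr[OF assms] by (rule no_return_Suc_limit)
  then show s: "survive = pi" using survive_limit LIMSEQ_unique by blast
  have split: "Pr m (avoids {b}) = Pr m (avoids {0, b}) + Pr m (returned {b} 1)" for m
    unfolding avg_add[symmetric] by (intro avg_cong)
      (auto simp: avoids_insert[of 0 "{b}"] returned_def Suc_le_eq simp flip: returns_0_iff)
  have "(\<lambda>m. Pr m (avoids {b}) * ln (real m)) \<longlonglongrightarrow> escape + first_return ^ 1 * survive"
    unfolding split distrib_right by (intro tendsto_add avoid_limit returned_limit)
  then have "survive = escape + first_return * survive"
    using survive_limit LIMSEQ_unique by fastforce
  moreover have e: "escape = pi * first_return"
    using total_hit by (simp add: escape_def)
  ultimately have "pi * (2 * first_return) = pi * 1" using s by (simp add: algebra_simps)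
  then show "first_return = 1 / 2" by simp
  then show "escape = pi / 2" using e by simp
qed

subsection \<open>Counting boundary points\<close>

text \<open>Every point of the range is counted once, at the time of its last visit up to n.\<close>

lemma card_last_visits:
  fixes s :: "nat \<Rightarrow> 'a"
  shows "real (card {x \<in> s ` {0..n}. C x}) = (\<Sum>i\<le>n. of_bool (C (s i) \<and> (\<forall>j\<in>{i<..n}. s j \<noteq> s i)))"
proof -
  define S where "S = {i. i \<le> n \<and> C (s i) \<and> (\<forall>j\<in>{i<..n}. s j \<noteq> s i)}"
  have "inj_on s S"
  proof (rule inj_onI)
    fix i j assume "i \<in> S" "j \<in> S" "s i = s j"
    then show "i = j"
      unfolding S_def by (cases i j rule: linorder_cases) force+
  qed
  moreover have "s ` S = {x \<in> s ` {0..n}. C x}"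
  proof (intro equalityI subsetI)
    fix x assume x: "x \<in> {x \<in> s ` {0..n}. C x}"
    define i where "i = Max {i. i \<le> n \<and> s i = x}"
    have "i \<in> {i. i \<le> n \<and> s i = x}"
      unfolding i_def using x by (intro Max_in) auto
    moreover have "j \<le> i" if "j \<le> n" "s j = x" for j
      unfolding i_def using that by (intro Max_ge) auto
    ultimately have "i \<in> S" "s i = x"
      using x unfolding S_def by (auto simp: not_le[symmetric])
    then show "x \<in> s ` S" by blast
  qed (auto simp: S_def)
  ultimately have "card {x \<in> s ` {0..n}. C x} = card S"
    using card_image by metis
  also have "real (card S) = (\<Sum>i\<le>n. of_bool (C (s i) \<and> (\<forall>j\<in>{i<..n}. s j \<noteq> s i)))"
    by (simp add: S_def atMost_def Int_def)
  finally show ?thesis .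
qed

text \<open>\<open>W\<close> is a condition on the number of visits, which lets \<open>L\<close>,
  \<open>J_exact\<close> and \<open>J_atleast\<close> share one treatment.\<close>

definition unvisited_count :: "(int \<times> int) set \<Rightarrow> (nat \<Rightarrow> bool) \<Rightarrow> (int \<times> int) list \<Rightarrow> nat" where
  "unvisited_count B W v = card {x \<in> pos v ` {0..length v}. (\<forall>b\<in>B. x + b \<notin> pos v ` {0..length v}) \<and>
    W (card {m. m \<le> length v \<and> pos v m = x})}"

definition boundary_count :: "(nat \<Rightarrow> bool) \<Rightarrow> (int \<times> int) list \<Rightarrow> nat" where
  "boundary_count W v = card {x \<in> pos v ` {0..length v}. (\<exists>b\<in>nbrs 0. x + b \<notin> pos v ` {0..length v}) \<and>
    W (card {m. m \<le> length v \<and> pos v m = x})}"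

text \<open>\<open>u\<close> is the past of time i run backwards from \<open>pos v i\<close>. The
  visit at time i is not a return of \<open>u\<close>, which accounts for \<open>Suc q\<close>; as
  it is the last one, no later time adds a visit.\<close>

lemma last_visit_split:
  assumes i: "i \<le> length v" and B: "0 \<notin> B"
  defines "u \<equiv> rev (map uminus (take i v))"
  shows "((\<forall>b\<in>B. pos v i + b \<notin> pos v ` {0..length v}) \<and> Suc q \<le> card {m. m \<le> length v \<and> pos v m = pos v i}) \<and>
      (\<forall>j\<in>{i<..length v}. pos v j \<noteq> pos v i) \<longleftrightarrow>
    returned B q u \<and> avoids (insert 0 B) (drop i v)"
proof -
  let ?n = "length v"
  have len: "length u = i" using i by (simp add: u_def)
  have pu: "pos u j = pos v (i - j) - pos v i" if "j \<le> i" for j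
    unfolding u_def using that i by (subst pos_reverse) (auto simp: min_def)
  have rev_ball: "(\<forall>j\<in>{1..i}. Q (i - j)) \<longleftrightarrow> (\<forall>j\<in>{..<i}. Q j)" for Q
  proof (intro iffI ballI)
    fix j assume "\<forall>j\<in>{1..i}. Q (i - j)" "j \<in> {..<i}"
    then show "Q j" by (auto dest!: bspec[of _ _ "i - j"])
  qed auto
  have av: "avoids B u \<longleftrightarrow> (\<forall>j\<in>{..<i}. pos v j - pos v i \<notin> B)"
    unfolding avoids_def len rev_ball[symmetric] by (auto simp: pu)
  have ret: "returns u = card {j. j < i \<and> pos v j = pos v i}"
    unfolding returns_def len
    by (rule bij_betw_same_card[of "\<lambda>j. i - j"], rule bij_betw_byWitness[where f' = "\<lambda>j. i - j"])
      (auto simp: pu)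
  have last: "avoids {0} (drop i v) \<longleftrightarrow> (\<forall>j\<in>{i<..?n}. pos v j \<noteq> pos v i)"
    using i by (simp add: avoids_drop)
  have "(\<forall>b\<in>B. pos v i + b \<notin> pos v ` {0..?n}) \<longleftrightarrow> (\<forall>j\<in>{0..?n}. pos v j - pos v i \<notin> B)"
  proof -
    have "(\<forall>b\<in>B. p + b \<notin> A) \<longleftrightarrow> (\<forall>y\<in>A. y - p \<notin> B)" for A and p :: "int \<times> int"
    proof (intro iffI ballI notI)
      fix y assume "\<forall>b\<in>B. p + b \<notin> A" "y \<in> A" "y - p \<in> B"
      moreover have "p + (y - p) = y" by (simp add: algebra_simps)
      ultimately show False by metis
    next
      fix b assume "\<forall>y\<in>A. y - p \<notin> B" "b \<in> B" "p + b \<in> A"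
      then have "(p + b) - p \<notin> B" by blast
      then show False using \<open>b \<in> B\<close> by simp
    qed
    then show ?thesis by simp
  qed
  \<comment> \<open>Time i gives the difference 0, harmless because 0 is not in B.\<close>
  also have "\<dots> \<longleftrightarrow> (\<forall>j\<in>{..<i} \<union> {i} \<union> {i<..?n}. pos v j - pos v i \<notin> B)"
    using i by (intro ball_cong) auto
  finally have unv: "(\<forall>b\<in>B. pos v i + b \<notin> pos v ` {0..?n}) \<longleftrightarrow> avoids B u \<and> avoids B (drop i v)"
    using av B i by (auto simp: avoids_drop)
  have vis: "card {m. m \<le> ?n \<and> pos v m = pos v i} = Suc (returns u)" if "\<forall>j\<in>{i<..?n}. pos v j \<noteq> pos v i"
  proof -
    have "{m. m \<le> ?n \<and> pos v m = pos v i} = insert i {j. j < i \<and> pos v j = pos v i}"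
      using that i by (auto simp: not_less[symmetric])
    then show ?thesis by (simp add: ret)
  qed
  show ?thesis
    unfolding unv avoids_insert[of 0 B] last returned_def using vis by auto
qed

text \<open>Past and future of the last visit are independent by \<open>avg_split\<close>, and
  \<open>avg_reverse\<close> removes the reversal of the past.\<close>

lemma avg_unvisited_count:
  assumes "0 \<notin> B"
  shows "avg n (\<lambda>v. real (unvisited_count B (\<lambda>k. Suc q \<le> k) v)) =
    (\<Sum>i\<le>n. Pr i (returned B q) * Pr (n - i) (avoids (insert 0 B)))"
proof -
  have "avg n (\<lambda>v. real (unvisited_count B (\<lambda>k. Suc q \<le> k) v)) = avg n (\<lambda>v. \<Sum>i\<le>n.
      of_bool (returned B q (rev (map uminus (take i v)))) * of_bool (avoids (insert 0 B) (drop i v)))"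
  proof (rule avg_cong)
    fix v assume "v \<in> paths n"
    then have len: "length v = n" by auto
    show "real (unvisited_count B (\<lambda>k. Suc q \<le> k) v) = (\<Sum>i\<le>n.
      of_bool (returned B q (rev (map uminus (take i v)))) * of_bool (avoids (insert 0 B) (drop i v)))"
      unfolding unvisited_count_def card_last_visits
      unfolding len of_bool_conj[symmetric] by (intro sum.cong refl arg_cong[where f = of_bool])
        (use last_visit_split[OF _ assms, of _ v q] len in auto)
  qed
  also have "\<dots> = (\<Sum>i\<le>n. Pr i (\<lambda>u. returned B q (rev (map uminus u))) * Pr (n - i) (avoids (insert 0 B)))"
    unfolding avg_sum by (intro sum.cong refl avg_split) auto
  also have "\<dots> = (\<Sum>i\<le>n. Pr i (returned B q) * Pr (n - i) (avoids (insert 0 B)))"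
    by (intro sum.cong refl arg_cong2[where f = "(*)"] avg_reverse)
  finally show ?thesis .
qed

text \<open>Reduces exact visit counts to thresholds, whose averages are the convolutions of
  \<open>avg_unvisited_count\<close>.\<close>

lemma unvisited_count_eq:
  "real (unvisited_count B (\<lambda>k. k = Suc q) v) =
    real (unvisited_count B (\<lambda>k. Suc q \<le> k) v) - real (unvisited_count B (\<lambda>k. Suc (Suc q) \<le> k) v)"
proof -
  define S where "S W = {x \<in> pos v ` {0..length v}. (\<forall>b\<in>B. x + b \<notin> pos v ` {0..length v}) \<and>
    W (card {m. m \<le> length v \<and> pos v m = x})}" for W
  have fin: "finite (S W)" for W by (simp add: S_def)
  have "S (\<lambda>k. Suc q \<le> k) = S (\<lambda>k. k = Suc q) \<union> S (\<lambda>k. Suc (Suc q) \<le> k)"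
    "S (\<lambda>k. k = Suc q) \<inter> S (\<lambda>k. Suc (Suc q) \<le> k) = {}"
    by (auto simp: S_def)
  then have "card (S (\<lambda>k. Suc q \<le> k)) = card (S (\<lambda>k. k = Suc q)) + card (S (\<lambda>k. Suc (Suc q) \<le> k))"
    using fin card_Un_disjoint by metis
  then show ?thesis by (simp add: unvisited_count_def S_def)
qed

lemma of_bool_bex_inclusion_exclusion:
  assumes "finite N"
  shows "of_bool (\<exists>b\<in>N. P b) = (\<Sum>B\<in>Pow N - {{}}. (- 1) ^ (card B + 1) * of_bool (\<forall>b\<in>B. P b) :: real)"
proof -
  have prod: "(\<Prod>b\<in>B. of_bool (Q b) :: real) = of_bool (\<forall>b\<in>B. Q b)" if "finite B" for B Q
    using that by (induction B) auto
  have "1 - of_bool (\<exists>b\<in>N. P b) = (\<Prod>b\<in>N. 1 - of_bool (P b) :: real)"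
    using prod[OF assms, of "\<lambda>b. \<not> P b"] by (simp add: of_bool_not_iff[symmetric])
  also have "\<dots> = (\<Sum>B\<in>Pow N. (- 1) ^ card B * (\<Prod>b\<in>B. of_bool (P b)))"
    by (subst prod_diff_conv_sum[OF assms]) simp
  also have "\<dots> = (\<Sum>B\<in>Pow N. (- 1) ^ card B * of_bool (\<forall>b\<in>B. P b))"
    by (intro sum.cong refl) (simp add: prod finite_subset[OF _ assms])
  \<comment> \<open>The term of the empty set is 1 and cancels; what is left involves only nonempty
    B, to which \<open>boundary_set\<close> applies.\<close>
  also have "\<dots> = 1 + (\<Sum>B\<in>Pow N - {{}}. (- 1) ^ card B * of_bool (\<forall>b\<in>B. P b))"
    using assms by (subst sum.remove[of _ "{}"]) auto
  finally show ?thesis by (simp add: sum_negf)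
qed

lemma boundary_count_inclusion_exclusion:
  "real (boundary_count W v) =
    (\<Sum>B\<in>Pow (nbrs 0) - {{}}. (- 1) ^ (card B + 1) * real (unvisited_count B W v))"
proof -
  define R where "R = pos v ` {0..length v}"
  define V where "V x \<longleftrightarrow> W (card {m. m \<le> length v \<and> pos v m = x})" for x
  have [simp]: "finite R" by (simp add: R_def)
  have card: "real (card {x \<in> R. P x \<and> V x}) = (\<Sum>x\<in>R. of_bool (V x) * of_bool (P x))" for P
    by (simp add: Int_def conj_commute flip: of_bool_conj)
  have "real (boundary_count W v) = (\<Sum>x\<in>R. of_bool (V x) * of_bool (\<exists>b\<in>nbrs 0. x + b \<notin> R))"
    unfolding boundary_count_def card[symmetric] by (simp add: R_def V_def)
  also have "\<dots> = (\<Sum>B\<in>Pow (nbrs 0) - {{}}. (- 1) ^ (card B + 1) * (\<Sum>x\<in>R. of_bool (V x) * of_bool (\<forall>b\<in>B. x + b \<notin> R)))"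
    unfolding of_bool_bex_inclusion_exclusion[OF finite_nbrs_0] sum_distrib_left
    by (subst sum.swap) (intro sum.cong refl, simp add: mult_ac)
  also have "(\<lambda>B. \<Sum>x\<in>R. of_bool (V x) * of_bool (\<forall>b\<in>B. x + b \<notin> R)) = (\<lambda>B. real (unvisited_count B W v))"
    unfolding unvisited_count_def card[symmetric] by (simp add: R_def V_def)
  finally show ?thesis .
qed

text \<open>The boundary is the union over the four neighbours b of the sets where x + b is
  unvisited.\<close>

lemma boundary_count_bounds:
  assumes "b \<in> nbrs 0"
  shows "unvisited_count {b} W v \<le> boundary_count W v"
    and "boundary_count W v \<le> (\<Sum>b\<in>nbrs 0. unvisited_count {b} W v)"
proof -
  define S where "S b = {x \<in> pos v ` {0..length v}. (\<forall>b'\<in>{b}. x + b' \<notin> pos v ` {0..length v}) \<and>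
    W (card {m. m \<le> length v \<and> pos v m = x})}" for b
  have S: "boundary_count W v = card (\<Union>b\<in>nbrs 0. S b)"
    unfolding boundary_count_def by (rule arg_cong[where f = card]) (auto simp: S_def)
  have c: "unvisited_count {b} W v = card (S b)" for b
    by (simp add: unvisited_count_def S_def)
  show "unvisited_count {b} W v \<le> boundary_count W v"
    unfolding S c using assms by (intro card_mono) (auto simp: S_def)
  show "boundary_count W v \<le> (\<Sum>b\<in>nbrs 0. unvisited_count {b} W v)"
    unfolding S c by (rule card_UN_le) simp
qed

text \<open>The signed sum over B is used only for the existence of the limit; the bounds come from
  \<open>boundary_count_bounds\<close>, with the factor 4 from the number of neighbours.\<close>

lemma boundary_count_limit:
  assumes lim: "\<And>B. B \<subseteq> nbrs 0 \<Longrightarrow> B \<noteq> {} \<Longrightarrow>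
      (\<lambda>n. avg n (\<lambda>v. real (unvisited_count B W v)) * ((ln (real n))\<^sup>2 / real n)) \<longlonglongrightarrow> \<kappa> B"
    and single: "\<And>b. b \<in> nbrs 0 \<Longrightarrow> \<kappa> {b} = \<mu>"
  shows "\<exists>l. (\<lambda>n. avg n (\<lambda>v. real (boundary_count W v)) * ((ln (real n))\<^sup>2 / real n)) \<longlonglongrightarrow> l \<and> \<mu> \<le> l \<and> l \<le> 4 * \<mu>"
proof -
  let ?s = "\<lambda>n. (ln (real n))\<^sup>2 / real n"
  let ?E = "\<lambda>n. avg n (\<lambda>v. real (boundary_count W v)) * ?s n"
  define l where "l = (\<Sum>B\<in>Pow (nbrs 0) - {{}}. (- 1) ^ (card B + 1) * \<kappa> B)"
  have "(\<lambda>n. \<Sum>B\<in>Pow (nbrs 0) - {{}}. (- 1) ^ (card B + 1) * (avg n (\<lambda>v. real (unvisited_count B W v)) * ?s n)) \<longlonglongrightarrow> l"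
    unfolding l_def by (intro tendsto_sum tendsto_mult_left lim) auto
  also have "(\<lambda>n. \<Sum>B\<in>Pow (nbrs 0) - {{}}. (- 1) ^ (card B + 1) * (avg n (\<lambda>v. real (unvisited_count B W v)) * ?s n)) = ?E"
    unfolding boundary_count_inclusion_exclusion avg_sum avg_cmult sum_distrib_right mult.assoc ..
  finally have l: "?E \<longlonglongrightarrow> l" .
  have b: "(1, 0) \<in> nbrs 0" by (simp add: nbrs_0)
  have "(\<lambda>n. avg n (\<lambda>v. real (unvisited_count {(1, 0)} W v)) * ?s n) \<longlonglongrightarrow> \<mu>"
    using lim[of "{(1, 0)}"] single[OF b] b by simp
  then have "\<mu> \<le> l"
  proof (rule LIMSEQ_le[OF _ l], intro exI[of _ 0] allI impI)
    show "avg n (\<lambda>v. real (unvisited_count {(1, 0)} W v)) * ?s n \<le> ?E n" for n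
      by (intro mult_right_mono avg_mono) (simp_all add: boundary_count_bounds(1)[OF b])
  qed
  moreover have "(\<lambda>n. (\<Sum>b\<in>nbrs 0. avg n (\<lambda>v. real (unvisited_count {b} W v)) * ?s n)) \<longlonglongrightarrow> (\<Sum>b\<in>nbrs 0. \<mu>)"
    using lim single by (intro tendsto_sum) force
  then have "l \<le> (\<Sum>b\<in>nbrs 0. \<mu>)"
  proof (rule LIMSEQ_le[OF l], intro exI[of _ 0] allI impI)
    fix n
    have "avg n (\<lambda>v. real (boundary_count W v)) \<le> avg n (\<lambda>v. \<Sum>b\<in>nbrs 0. real (unvisited_count {b} W v))"
      using boundary_count_bounds(2)[OF b, of W]
      by (intro avg_mono) (simp only: of_nat_sum[symmetric] of_nat_le_iff)
    then show "?E n \<le> (\<Sum>b\<in>nbrs 0. avg n (\<lambda>v. real (unvisited_count {b} W v)) * ?s n)"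
      unfolding avg_sum sum_distrib_right[symmetric] by (rule mult_right_mono) simp
  qed
  ultimately show ?thesis using l by (auto simp: card_nbrs_0)
qed

text \<open>For one neighbour \<open>survive * escape\<close> is pi * (pi / 2), and q returns add (1
  / 2) ^ q. The exact count is the difference of the values for q and q + 1, which halves the
  constant to pi^2 / 4.\<close>

lemma boundary_count_atleast_limit:
  "\<exists>l. (\<lambda>n. avg n (\<lambda>v. real (boundary_count (\<lambda>k. Suc q \<le> k) v)) * ((ln (real n))\<^sup>2 / real n)) \<longlonglongrightarrow> l \<and>
    (1 / 2) ^ q * (pi\<^sup>2 / 2) \<le> l \<and> l \<le> 4 * ((1 / 2) ^ q * (pi\<^sup>2 / 2))"
  and boundary_count_exact_limit:
  "\<exists>l. (\<lambda>n. avg n (\<lambda>v. real (boundary_count (\<lambda>k. k = Suc q) v)) * ((ln (real n))\<^sup>2 / real n)) \<longlonglongrightarrow> l \<and>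
    (1 / 2) ^ q * (pi\<^sup>2 / 4) \<le> l \<and> l \<le> 4 * ((1 / 2) ^ q * (pi\<^sup>2 / 4))"
proof -
  define \<kappa> where "\<kappa> q B = boundary_set.first_return B ^ q * boundary_set.survive B * boundary_set.escape B" for q B
  have lim: "(\<lambda>n. avg n (\<lambda>v. real (unvisited_count B (\<lambda>k. Suc q \<le> k) v)) * ((ln (real n))\<^sup>2 / real n)) \<longlonglongrightarrow> \<kappa> q B"
    if "B \<subseteq> nbrs 0" "B \<noteq> {}" for B q
  proof -
    interpret boundary_set B using that by unfold_locales
    show ?thesis
      unfolding avg_unvisited_count[OF zero_notin_B] \<kappa>_def
      by (rule log_log_convolution_limit[OF returned_limit avoid_limit])
  qed
  have single: "\<kappa> q {b} = (1 / 2) ^ q * (pi\<^sup>2 / 2)" if "b \<in> nbrs 0" for b q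
    unfolding \<kappa>_def single_nbr_constants[OF that] by (simp add: power2_eq_square)
  show "\<exists>l. (\<lambda>n. avg n (\<lambda>v. real (boundary_count (\<lambda>k. Suc q \<le> k) v)) * ((ln (real n))\<^sup>2 / real n)) \<longlonglongrightarrow> l \<and>
      (1 / 2) ^ q * (pi\<^sup>2 / 2) \<le> l \<and> l \<le> 4 * ((1 / 2) ^ q * (pi\<^sup>2 / 2))"
    by (rule boundary_count_limit[where \<kappa> = "\<kappa> q"]) (use lim single in auto)
  show "\<exists>l. (\<lambda>n. avg n (\<lambda>v. real (boundary_count (\<lambda>k. k = Suc q) v)) * ((ln (real n))\<^sup>2 / real n)) \<longlonglongrightarrow> l \<and>
      (1 / 2) ^ q * (pi\<^sup>2 / 4) \<le> l \<and> l \<le> 4 * ((1 / 2) ^ q * (pi\<^sup>2 / 4))"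
  proof (rule boundary_count_limit[where \<kappa> = "\<lambda>B. \<kappa> q B - \<kappa> (Suc q) B"])
    fix B assume "B \<subseteq> nbrs 0" "B \<noteq> {}"
    then show "(\<lambda>n. avg n (\<lambda>v. real (unvisited_count B (\<lambda>k. k = Suc q) v)) * ((ln (real n))\<^sup>2 / real n))
        \<longlonglongrightarrow> \<kappa> q B - \<kappa> (Suc q) B"
      unfolding unvisited_count_eq avg_diff left_diff_distrib by (intro tendsto_diff lim)
  qed (simp add: single)
qed

subsection \<open>Transfer to the random walk\<close>

context simple_random_walk_Z2
begin

definition steps :: "nat \<Rightarrow> 'a \<Rightarrow> (int \<times> int) list" where
  "steps n \<omega> = map (\<lambda>i. X i \<omega>) [1..<Suc n]"

lemma length_steps [simp]: "length (steps n \<omega>) = n"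
  by (simp add: steps_def)

lemma pos_steps: "k \<le> n \<Longrightarrow> pos (steps n \<omega>) k = walk X \<omega> k"
  by (simp add: pos_def steps_def walk_def take_map take_upt interv_sum_list_conv_sum_set_nat
      atLeastLessThanSuc_atLeastAtMost del: upt_Suc)

lemma X_measurable: "i \<ge> 1 \<Longrightarrow> random_variable (count_space UNIV) (X i)"
  using steps_indep by (auto simp: indep_vars_def2)

lemma prob_X: "i \<ge> 1 \<Longrightarrow> e \<in> nbrs 0 \<Longrightarrow> prob (X i -` {e} \<inter> space M) = 1 / 4"
  using measure_distr[OF X_measurable, of i "{e}"] steps_uniform[of i] card_nbrs_0 pmf_of_set[of "nbrs 0" e]
  by (auto simp: measure_pmf_single)

text \<open>The leading \<open>space M\<close> matters for n = 0, where the indexed intersection is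
  the whole type.\<close>

lemma steps_eq: "length v = n \<Longrightarrow> steps n -` {v} \<inter> space M = space M \<inter> (\<Inter>i\<in>{1..n}. X i -` {v ! (i - 1)} \<inter> space M)"
proof -
  assume v: "length v = n"
  have "steps n \<omega> = v \<longleftrightarrow> (\<forall>i\<in>{1..n}. X i \<omega> = v ! (i - 1))" for \<omega>
  proof -
    have "steps n \<omega> = v \<longleftrightarrow> (\<forall>j<n. X (Suc j) \<omega> = v ! j)"
      using v by (auto simp: list_eq_iff_nth_eq steps_def simp del: upt_Suc)
    also have "\<dots> \<longleftrightarrow> (\<forall>i\<in>{1..n}. X i \<omega> = v ! (i - 1))"
    proof (intro iffI ballI allI impI)
      fix i assume "\<forall>j<n. X (Suc j) \<omega> = v ! j" "i \<in> {1..n}"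
      then show "X i \<omega> = v ! (i - 1)" by (cases i) auto
    next
      fix j assume "\<forall>i\<in>{1..n}. X i \<omega> = v ! (i - 1)" "j < n"
      then show "X (Suc j) \<omega> = v ! j" by (auto dest!: bspec[of _ _ "Suc j"])
    qed
    finally show ?thesis .
  qed
  then show ?thesis by auto
qed

lemma steps_sets: "steps n -` {v} \<inter> space M \<in> sets M"
proof (cases "length v = n")
  case True
  have X: "X i -` {v ! (i - 1)} \<inter> space M \<in> sets M" if "i \<in> {1..n}" for i
    using that measurable_sets[OF X_measurable, of i "{v ! (i - 1)}"] by simp
  show ?thesis
  proof (cases "n = 0")
    case n0: False
    then show ?thesis
      unfolding steps_eq[OF True] by (intro sets.Int[OF sets.top] sets.finite_INT X) auto
  next
    case n0: True
    show ?thesis unfolding steps_eq[OF True] unfolding n0 by simp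
  qed
next
  case False
  then have "steps n -` {v} \<inter> space M = {}" by auto
  then show ?thesis by simp
qed

lemma steps_measurable: "steps n \<in> measurable M (count_space UNIV)"
  by (subst measurable_count_space_eq2_countable) (auto simp: steps_sets)

lemma prob_steps:
  assumes "v \<in> paths n"
  shows "prob (steps n -` {v} \<inter> space M) = 1 / 4 ^ n"
proof (cases "n = 0")
  case True
  then have "steps n -` {v} \<inter> space M = space M" using assms by (auto simp: paths_def steps_def)
  then show ?thesis using True prob_space by simp
next
  case False
  have v: "length v = n" "set v \<subseteq> nbrs 0" using assms by (auto simp: paths_def)
  have "space M \<inter> (\<Inter>i\<in>{1..n}. X i -` {v ! (i - 1)} \<inter> space M) = (\<Inter>i\<in>{1..n}. X i -` {v ! (i - 1)} \<inter> space M)"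
    using False by auto
  then have "prob (steps n -` {v} \<inter> space M) = (\<Prod>i\<in>{1..n}. prob (X i -` {v ! (i - 1)} \<inter> space M))"
    unfolding steps_eq[OF v(1)] using indep_varsD[OF steps_indep, of "{1..n}" "\<lambda>i. {v ! (i - 1)}"] False by auto
  also have "\<dots> = (\<Prod>i\<in>{1..n}. 1 / 4)"
  proof (rule prod.cong[OF refl])
    fix i assume i: "i \<in> {1..n}"
    then have "v ! (i - 1) \<in> set v" using v(1) by (intro nth_mem) auto
    then have "v ! (i - 1) \<in> nbrs 0" using v(2) by blast
    then show "prob (X i -` {v ! (i - 1)} \<inter> space M) = 1 / 4"
      using i by (intro prob_X) auto
  qed
  finally show ?thesis by (simp add: power_one_over)
qed

text \<open>The 4 ^ n lists in \<open>paths n\<close> carry mass 1 in total, so almost surely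
  \<open>steps n\<close> is one of them and the expectation becomes a finite sum.\<close>

lemma expectation_steps: "expectation (\<lambda>\<omega>. \<phi> (steps n \<omega>)) = avg n \<phi>"
proof -
  let ?A = "\<lambda>v. steps n -` {v} \<inter> space M"
  have "prob (\<Union>v\<in>paths n. ?A v) = (\<Sum>v\<in>paths n. prob (?A v))"
    by (rule finite_measure_finite_Union) (auto simp: disjoint_family_on_def steps_sets)
  also have "\<dots> = 1" by (simp add: prob_steps card_paths)
  finally have "AE \<omega> in M. \<omega> \<in> (\<Union>v\<in>paths n. ?A v)"
    by (rule AE_prob_1)
  then have ae: "AE \<omega> in M. \<phi> (steps n \<omega>) = (\<Sum>v\<in>paths n. \<phi> v * indicator (?A v) \<omega>)"
  proof (eventually_elim)
    fix \<omega> assume \<omega>: "\<omega> \<in> (\<Union>v\<in>paths n. ?A v)"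
    then have "(\<Sum>v\<in>paths n. \<phi> v * indicator (?A v) \<omega>) = (\<Sum>v\<in>paths n. if steps n \<omega> = v then \<phi> v else 0)"
      by (intro sum.cong) (auto simp: indicator_def)
    then show "\<phi> (steps n \<omega>) = (\<Sum>v\<in>paths n. \<phi> v * indicator (?A v) \<omega>)"
      using \<omega> by auto
  qed
  have meas: "(\<lambda>\<omega>. \<phi> (steps n \<omega>)) \<in> borel_measurable M"
    using measurable_compose[OF steps_measurable, of \<phi> borel] by simp
  have "expectation (\<lambda>\<omega>. \<phi> (steps n \<omega>)) = expectation (\<lambda>\<omega>. \<Sum>v\<in>paths n. \<phi> v * indicator (?A v) \<omega>)"
    by (rule integral_cong_AE[OF meas _ ae])
      (intro borel_measurable_sum borel_measurable_times borel_measurable_const borel_measurable_indicator steps_sets)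
  also have "\<dots> = (\<Sum>v\<in>paths n. \<phi> v * prob (?A v))"
    using steps_sets[of n] by (subst Bochner_Integration.integral_sum) (auto simp: less_top[symmetric])
  also have "\<dots> = avg n \<phi>"
    by (simp add: prob_steps avg_def sum_divide_distrib)
  finally show ?thesis .
qed

lemma prob_steps_event:
  shows "{\<omega> \<in> space M. P (steps n \<omega>)} \<in> sets M"
    and "prob {\<omega> \<in> space M. P (steps n \<omega>)} = Pr n P"
proof -
  have "steps n -` {v. P v} \<inter> space M \<in> sets M"
    by (rule measurable_sets[OF steps_measurable]) simp
  moreover have eq: "steps n -` {v. P v} \<inter> space M = {\<omega> \<in> space M. P (steps n \<omega>)}" by auto
  ultimately show s: "{\<omega> \<in> space M. P (steps n \<omega>)} \<in> sets M" by simp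
  have "Pr n P = expectation (indicator {\<omega> \<in> space M. P (steps n \<omega>)})"
    unfolding expectation_steps[symmetric] by (intro Bochner_Integration.integral_cong) (auto simp: indicator_def)
  then show "prob {\<omega> \<in> space M. P (steps n \<omega>)} = Pr n P"
    using s by simp
qed

lemma boundary_steps:
  "{x \<in> inner_boundary (walk X \<omega>) n. W (visits (walk X \<omega>) n x)} =
    {x \<in> pos (steps n \<omega>) ` {0..length (steps n \<omega>)}.
      (\<exists>b\<in>nbrs 0. x + b \<notin> pos (steps n \<omega>) ` {0..length (steps n \<omega>)}) \<and>
      W (card {m. m \<le> length (steps n \<omega>) \<and> pos (steps n \<omega>) m = x})}"
proof -
  have R: "walk_range (walk X \<omega>) n = pos (steps n \<omega>) ` {0..n}"
    unfolding walk_range_def by (rule image_cong) (auto simp: pos_steps)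
  have V: "visits (walk X \<omega>) n x = card {m. m \<le> n \<and> pos (steps n \<omega>) m = x}" for x
    unfolding visits_def by (rule arg_cong[where f = card]) (auto simp: pos_steps)
  have "inner_boundary (walk X \<omega>) n = {x \<in> walk_range (walk X \<omega>) n. \<not> nbrs x \<subseteq> walk_range (walk X \<omega>) n}"
    unfolding inner_boundary_def walk_range_def set_eq_iff mem_Collect_eq image_iff Bex_def atLeastAtMost_iff
    by blast
  also have "\<dots> = {x \<in> walk_range (walk X \<omega>) n. \<exists>b\<in>nbrs 0. x + b \<notin> walk_range (walk X \<omega>) n}"
  proof -
    have "\<not> nbrs x \<subseteq> R \<longleftrightarrow> (\<exists>b\<in>nbrs 0. x + b \<notin> R)" for x R
      by (subst nbrs_add) blast
    then show ?thesis by simp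
  qed
  finally show ?thesis unfolding V R length_steps by auto
qed

lemma expectation_boundary:
  "expectation (\<lambda>\<omega>. real (card {x \<in> inner_boundary (walk X \<omega>) n. W (visits (walk X \<omega>) n x)})) =
    avg n (\<lambda>v. real (boundary_count W v))"
  unfolding boundary_steps boundary_count_def[symmetric] by (rule expectation_steps)

text \<open>Boundary points lie in the range, so each has a visit; this makes \<open>L\<close> the
  threshold count for p = 1.\<close>

lemma L_conv_visits: "L s n = card {x \<in> inner_boundary s n. 1 \<le> visits s n x}"
proof -
  have "1 \<le> visits s n x" if "x \<in> inner_boundary s n" for x
  proof -
    have "\<exists>i. x = s i \<and> i \<le> n"
      using that unfolding inner_boundary_def mem_Collect_eq by (elim exE conjE) (intro exI conjI)
    then have "{m. m \<le> n \<and> s m = x} \<noteq> {}" by (elim exE) auto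
    then have "card {m. m \<le> n \<and> s m = x} \<noteq> 0" by (subst card_0_eq) auto
    then show ?thesis unfolding visits_def by linarith
  qed
  then have "{x \<in> inner_boundary s n. 1 \<le> visits s n x} = inner_boundary s n" by blast
  then show ?thesis by (simp add: L_def)
qed

text \<open>The strict inequality forces a finite return time, so the comparison of two possibly
  infinite times becomes a union of events decided at finite times k.\<close>

lemma T_less_iff:
  assumes "b \<noteq> 0"
  shows "T s 0 < T s b \<longleftrightarrow> (\<exists>k\<ge>1. s k = 0 \<and> (\<forall>j\<in>{1..<k}. s j \<notin> {0, b}))"
proof
  assume less: "T s 0 < T s b"
  define k where "k = (LEAST m. m \<ge> 1 \<and> s m = 0)"
  have "{m. m \<ge> 1 \<and> s m = 0} \<noteq> {}"
  proof
    assume "{m. m \<ge> 1 \<and> s m = 0} = {}"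
    then have "T s 0 = \<top>" unfolding T_def by (simp only: image_empty Inf_empty)
    then show False using less by simp
  qed
  then have k: "k \<ge> 1" "s k = 0" and min: "\<And>m. m \<ge> 1 \<Longrightarrow> s m = 0 \<Longrightarrow> k \<le> m"
    unfolding k_def by (auto intro: LeastI2_ex Least_le)
  have "enat k \<le> T s 0"
    unfolding T_def using min by (intro INF_greatest) auto
  have "s j \<noteq> b" if "j \<ge> 1" "j < k" for j
  proof
    assume "s j = b"
    then have "T s b \<le> enat j"
      unfolding T_def using that by (intro INF_lower) auto
    also have "enat j < enat k" using that by simp
    finally show False using \<open>enat k \<le> T s 0\<close> less by (meson less_le_trans not_less_iff_gr_or_eq)
  qed
  then show "\<exists>k\<ge>1. s k = 0 \<and> (\<forall>j\<in>{1..<k}. s j \<notin> {0, b})"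
    using k min by (intro exI[of _ k]) force
next
  assume "\<exists>k\<ge>1. s k = 0 \<and> (\<forall>j\<in>{1..<k}. s j \<notin> {0, b})"
  then obtain k where k: "k \<ge> 1" "s k = 0" "\<And>j. j \<ge> 1 \<Longrightarrow> j < k \<Longrightarrow> s j \<noteq> b" by auto
  have "T s 0 \<le> enat k"
    unfolding T_def using k by (intro INF_lower) auto
  also have "enat k < enat (Suc k)" by simp
  also have "enat (Suc k) \<le> T s b"
    unfolding T_def
  proof (rule INF_greatest)
    fix m assume "m \<in> {m. 1 \<le> m \<and> s m = b}"
    then have "m \<ge> 1" "s m = b" by auto
    \<comment> \<open>\<open>s k = 0\<close> and b \<noteq> 0 exclude m = k, so \<open>T s b\<close>
      is at least \<open>Suc k\<close>.\<close>
    then have "\<not> m < k" "m \<noteq> k" using k assms by auto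
    then show "enat (Suc k) \<le> enat m" by simp
  qed
  finally show "T s 0 < T s b" .
qed

text \<open>The events that the first entrance into {0, b} is at 0 and at time k are disjoint, and
  their probabilities are the terms of \<open>first_return\<close>.\<close>

lemma prob_return_before:
  assumes "b \<in> nbrs 0"
  shows "prob {\<omega> \<in> space M. T (walk X \<omega>) 0 < T (walk X \<omega>) b} = boundary_set.first_return {b}"
proof -
  interpret B: boundary_set "{b}" using assms by unfold_locales auto
  have b0: "b \<noteq> 0" using assms zero_notin_nbrs_0 by blast
  define A where "A k = {\<omega> \<in> space M. hits {0, b} 0 (steps k \<omega>)}" for k
  have A: "A k = {\<omega> \<in> space M. k \<ge> 1 \<and> walk X \<omega> k = 0 \<and> (\<forall>j\<in>{1..<k}. walk X \<omega> j \<notin> {0, b})}" for k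
  proof -
    have "hits {0, b} 0 (steps k \<omega>) \<longleftrightarrow> k \<ge> 1 \<and> walk X \<omega> k = 0 \<and> (\<forall>j\<in>{1..<k}. walk X \<omega> j \<notin> {0, b})" for \<omega>
    proof -
      have "steps k \<omega> \<noteq> [] \<longleftrightarrow> k \<ge> 1" by (metis length_0_conv length_steps less_one not_le)
      then show ?thesis unfolding hits_def length_steps by (auto simp: pos_steps)
    qed
    then show ?thesis by (simp add: A_def)
  qed
  have "{\<omega> \<in> space M. T (walk X \<omega>) 0 < T (walk X \<omega>) b} = (\<Union>k. A k)"
    unfolding T_less_iff[OF b0] A by auto
  moreover have "(\<lambda>k. prob (A k)) sums prob (\<Union>k. A k)"
  proof (rule finite_measure_UNION)
    show "range A \<subseteq> events" unfolding A_def using prob_steps_event(1) by auto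
    show "disjoint_family A"
    proof (unfold disjoint_family_on_def, intro ballI impI)
      fix m n :: nat assume "m \<noteq> n"
      then show "A m \<inter> A n = {}" unfolding A by (cases m n rule: linorder_cases) auto
    qed
  qed
  ultimately show ?thesis
    by (simp add: B.first_return_def A_def prob_steps_event(2) sums_iff)
qed

end

theorem theorem2p4:
  fixes M :: "'a measure" and X :: "nat \<Rightarrow> 'a \<Rightarrow> int \<times> int"
    and p :: nat and b :: "int \<times> int" and c :: real
    and EL EJ_exact EJ_atleast :: "nat \<Rightarrow> real"
  assumes srw: "simple_random_walk_Z2 M X"
    and p: "p \<ge> 1"
    and b: "b \<in> nbrs 0"
  defines "c \<equiv> measure M {\<omega> \<in> space M. T (walk X \<omega>) 0 < T (walk X \<omega>) b}"
    and "EL \<equiv> \<lambda>n. (\<integral>\<omega>. real (L (walk X \<omega>) n) \<partial>M)"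
    and "EJ_exact \<equiv> \<lambda>n. (\<integral>\<omega>. real (J_exact p (walk X \<omega>) n) \<partial>M)"
    and "EJ_atleast \<equiv> \<lambda>n. (\<integral>\<omega>. real (J_atleast p (walk X \<omega>) n) \<partial>M)"
  shows "(\<exists>l. (\<lambda>n. EL n * ((ln (real n))\<^sup>2 / real n)) \<longlonglongrightarrow> l \<and>
              pi\<^sup>2 / 2 \<le> l \<and> l \<le> 2 * pi\<^sup>2) \<and>
         (\<exists>l. (\<lambda>n. EJ_exact n * ((ln (real n))\<^sup>2 / real n)) \<longlonglongrightarrow> l \<and>
              c ^ (p - 1) * pi\<^sup>2 / 4 \<le> l \<and> l \<le> c ^ (p - 1) * pi\<^sup>2) \<and>
         (\<exists>l. (\<lambda>n. EJ_atleast n * ((ln (real n))\<^sup>2 / real n)) \<longlonglongrightarrow> l \<and>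
              c ^ (p - 1) * pi\<^sup>2 / 2 \<le> l \<and> l \<le> 2 * c ^ (p - 1) * pi\<^sup>2)"
proof -
  interpret simple_random_walk_Z2 M X by (rule srw)
  obtain q where q: "p = Suc q" using p by (cases p) auto
  \<comment> \<open>With c = 1 / 2 and p - 1 = q the claimed bounds are those already found for the
    averages.\<close>
  have c: "c = 1 / 2"
    unfolding c_def prob_return_before[OF b] by (rule single_nbr_constants(1)[OF b])
  have EL: "EL n = avg n (\<lambda>v. real (boundary_count (\<lambda>k. Suc 0 \<le> k) v))" for n
    unfolding EL_def L_conv_visits One_nat_def by (rule expectation_boundary)
  have Ee: "EJ_exact n = avg n (\<lambda>v. real (boundary_count (\<lambda>k. k = Suc q) v))" for n
    unfolding EJ_exact_def J_exact_def q by (rule expectation_boundary)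
  have Ea: "EJ_atleast n = avg n (\<lambda>v. real (boundary_count (\<lambda>k. Suc q \<le> k) v))" for n
    unfolding EJ_atleast_def J_atleast_def q by (rule expectation_boundary)
  show ?thesis
    unfolding EL Ee Ea c q
    using boundary_count_atleast_limit[of 0] boundary_count_exact_limit[of q] boundary_count_atleast_limit[of q]
    by (simp add: mult_ac)
qed

end
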